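(* Let $M$ be a compact oriented smooth manifold of dimension $n\ge3$, possibly with boundary, let $\hat g$ be a Riemannian metric on $M$, and let $\beta\in\Omega^{n-1}(M)$ be a closed, nowhere vanishing $(n-1)$-form with $j_{\partial M}^*\beta=\beta_{\partial M}$ for a given $\beta_{\partial M}\in\Omega^{n-1}(\partial M)$, where $j_{\partial M}:\partial M\to M$ is the inclusion. Put $\bar g=|\beta|_{\hat g}^2\,\hat g$. Let $\mathcal V\subset\Omega^{n-1}(M)$ be any one of the following three classes of variations: (a) $\{\mathring\beta\in\Omega^{n-1}(M): d\mathring\beta=0,\ j_{\partial M}^*\mathring\beta=0\}$; (b) $\{d\alpha:\alpha\in\Omega^{n-2}(M),\ j_{\partial M}^*\alpha=0\}$; (c) $\{-\mathcal L_\xi\beta:\xi \text{ a smooth vector field compactly supported in the interior of } M\}$. Then $\beta$ is a stationary point of the squared $L^2$-norm with respect to $\hat g$ under variations in $\mathcal V$ if and only if $\beta$ is a stationary point of the $L^1$-norm with respect to $\bar g$ under variations in $\mathcal V$.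
   Context: All objects are smooth; $\mathcal L$ is the Lie derivative. For a metric $g$ with volume form $\mu_g$ and pointwise norm $|\cdot|_g$ on forms, $\|\gamma\|_{L^2,g}^2=\int_M|\gamma|_g^2\,\mu_g$ and $\|\gamma\|_{L^1,g}=\int_M|\gamma|_g\,\mu_g$ for $\gamma\in\Omega^{n-1}(M)$. The metrics $\hat g$ and $\bar g$ are held fixed when taking variations. For a functional $F$ on $\Omega^{n-1}(M)$, $\beta$ is a stationary point of $F$ under variations in $\mathcal V$ if $\frac{d}{dt}\big|_{t=0}F(\beta+t\mathring\beta)=0$ for all $\mathring\beta\in\mathcal V$. *)

theory Defs
  imports "HOL-Analysis.Analysis"
begin

text \<open>
  Manifolds with boundary are topological spaces with an atlas of charts onto relatively open
  subsets of a half space of \<open>real ^ 'n\<close>; the dimension is \<open>CARD('n)\<close>. Tensor fields are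
  represented classically, by their local representatives: one per chart, smooth in the coordinates
  of the chart, and related on overlaps by the derivatives of the coordinate changes.
  The linear order on the index type serves to single out the last coordinate (for the half space)
  and to enumerate the coordinates (for orientations and determinants).
\<close>

section \<open>Smooth functions\<close>

fun ck_on :: "nat \<Rightarrow> 'a::real_normed_vector set \<Rightarrow> ('a \<Rightarrow> 'b::real_normed_vector) \<Rightarrow> bool" where
  "ck_on 0 W f \<longleftrightarrow> continuous_on W f"
| "ck_on (Suc k) W f \<longleftrightarrow>
     (\<forall>x\<in>W. f differentiable (at x)) \<and> (\<forall>v. ck_on k W (\<lambda>x. frechet_derivative f (at x) v))"

text \<open>Smoothness on a not necessarily open set (of a half space, or of its boundary hyperplane):
  local existence of smooth extensions to open sets.\<close>

definition smooth_rel :: "'a::real_normed_vector set \<Rightarrow> ('a \<Rightarrow> 'b::real_normed_vector) \<Rightarrow> bool" where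
  "smooth_rel S f \<longleftrightarrow>
     (\<forall>x\<in>S. \<exists>W g. open W \<and> x \<in> W \<and> (\<forall>k. ck_on k W g) \<and> (\<forall>y\<in>S \<inter> W. g y = f y))"

section \<open>Oriented manifolds with boundary\<close>

type_synonym ('m, 'n) chart = "'m set \<times> ('m \<Rightarrow> real ^ 'n)"

abbreviation cdom :: "('m, 'n) chart \<Rightarrow> 'm set" where "cdom c \<equiv> fst c"
abbreviation cmap :: "('m, 'n) chart \<Rightarrow> 'm \<Rightarrow> real ^ 'n" where "cmap c \<equiv> snd c"
abbreviation cimg :: "('m, 'n) chart \<Rightarrow> (real ^ 'n) set" where "cimg c \<equiv> cmap c ` cdom c"

definition cinv :: "('m, 'n) chart \<Rightarrow> real ^ 'n \<Rightarrow> 'm" where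
  "cinv c = inv_into (cdom c) (cmap c)"

definition last_coord :: "'n::{finite, linorder}" where
  "last_coord = Max UNIV"

definition half_space :: "(real ^ 'n::{finite, linorder}) set" where
  "half_space = {x. x $ last_coord \<ge> 0}"

definition hyperplane :: "(real ^ 'n::{finite, linorder}) set" where
  "hyperplane = {x. x $ last_coord = 0}"

text \<open>The derivatives below are taken within relatively open subsets of the half space; there they
  are unique, also at boundary points.\<close>

definition trans_deriv ::
    "('m, 'n::finite) chart \<Rightarrow> ('m, 'n) chart \<Rightarrow> 'm \<Rightarrow> real ^ 'n \<Rightarrow> real ^ 'n" where
  "trans_deriv c c' p =
     frechet_derivative (cmap c' \<circ> cinv c) (at (cmap c p) within cmap c ` (cdom c \<inter> cdom c'))"

definition smooth_atlas :: "'m topology \<Rightarrow> ('m, 'n::{finite, linorder}) chart set \<Rightarrow> bool" where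
  "smooth_atlas X A \<longleftrightarrow>
     (\<Union>c\<in>A. cdom c) = topspace X \<and>
     (\<forall>c\<in>A. openin X (cdom c) \<and> openin (top_of_set half_space) (cimg c) \<and>
        homeomorphic_map (subtopology X (cdom c)) (top_of_set (cimg c)) (cmap c)) \<and>
     (\<forall>c\<in>A. \<forall>c'\<in>A. smooth_rel (cmap c ` (cdom c \<inter> cdom c')) (cmap c' \<circ> cinv c))"

text \<open>The orientation is the one for which all charts of the atlas are positive.\<close>

definition oriented_manifold :: "'m topology \<Rightarrow> ('m, 'n::{finite, linorder}) chart set \<Rightarrow> bool" where
  "oriented_manifold X A \<longleftrightarrow>
     Hausdorff_space X \<and> second_countable X \<and> smooth_atlas X A \<and>
     (\<forall>c\<in>A. \<forall>c'\<in>A. \<forall>p\<in>cdom c \<inter> cdom c'. det (matrix (trans_deriv c c' p)) > 0)"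

definition bdry :: "('m, 'n::{finite, linorder}) chart set \<Rightarrow> 'm set" where
  "bdry A = {p. \<exists>c\<in>A. p \<in> cdom c \<and> cmap c p \<in> hyperplane}"

section \<open>Differential forms\<close>

text \<open>Alternating \<open>k\<close>-forms on a subspace \<open>T\<close>, as functions of the list of their \<open>k\<close> arguments;
  they are 0 on all other lists, so that equality of forms is equality of functions.\<close>

definition alternating_on ::
    "'a::real_vector set \<Rightarrow> nat \<Rightarrow> ('a list \<Rightarrow> real) \<Rightarrow> bool" where
  "alternating_on T k f \<longleftrightarrow>
     (\<forall>vs. \<not> (length vs = k \<and> set vs \<subseteq> T) \<longrightarrow> f vs = 0) \<and>
     (\<forall>vs i u v a b. length vs = k \<and> set vs \<subseteq> T \<and> i < k \<and> u \<in> T \<and> v \<in> T \<longrightarrow>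
        f (vs[i := a *\<^sub>R u + b *\<^sub>R v]) = a * f (vs[i := u]) + b * f (vs[i := v])) \<and>
     (\<forall>vs i j. length vs = k \<and> set vs \<subseteq> T \<and> i < j \<and> j < k \<and> vs ! i = vs ! j \<longrightarrow> f vs = 0)"

text \<open>\<open>\<omega> c p\<close> is the representative in the chart \<open>c\<close> of the form \<open>\<omega>\<close> at the point \<open>p\<close>.\<close>

type_synonym ('m, 'n) form = "('m, 'n) chart \<Rightarrow> 'm \<Rightarrow> (real ^ 'n) list \<Rightarrow> real"

text \<open>Smooth \<open>k\<close>-forms on \<open>S\<close>, which is the manifold itself (with \<open>T = UNIV\<close>) or its boundary
  (with \<open>T = hyperplane\<close>, the tangent space of the boundary in every chart).\<close>

definition forms_on ::
    "('m, 'n::{finite, linorder}) chart set \<Rightarrow> 'm set \<Rightarrow> (real ^ 'n::{finite, linorder}) set \<Rightarrow> nat \<Rightarrow> ('m, 'n) form set" where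
  "forms_on A S T k = {\<omega>.
     (\<forall>c p. if c \<in> A \<and> p \<in> cdom c \<inter> S then alternating_on T k (\<omega> c p) else \<omega> c p = (\<lambda>_. 0)) \<and>
     (\<forall>c\<in>A. \<forall>vs. smooth_rel (cmap c ` (cdom c \<inter> S)) (\<lambda>x. \<omega> c (cinv c x) vs)) \<and>
     (\<forall>c\<in>A. \<forall>c'\<in>A. \<forall>p\<in>cdom c \<inter> cdom c' \<inter> S. \<forall>vs. set vs \<subseteq> T \<longrightarrow>
        \<omega> c p vs = \<omega> c' p (map (trans_deriv c c' p) vs))}"

definition Omega :: "'m topology \<Rightarrow> ('m, 'n::{finite, linorder}) chart set \<Rightarrow> nat \<Rightarrow> ('m, 'n) form set" where
  "Omega X A k = forms_on A (topspace X) UNIV k"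

definition Omega_bdry :: "('m, 'n::{finite, linorder}) chart set \<Rightarrow> nat \<Rightarrow> ('m, 'n) form set" where
  "Omega_bdry A k = forms_on A (bdry A) hyperplane k"

definition bdry_pullback :: "('m, 'n::{finite, linorder}) chart set \<Rightarrow> ('m, 'n) form \<Rightarrow> ('m, 'n) form" where
  "bdry_pullback A \<omega> = (\<lambda>c p vs. if p \<in> bdry A \<and> set vs \<subseteq> hyperplane then \<omega> c p vs else 0)"

abbreviation zero_form :: "('m, 'n) form" where "zero_form \<equiv> \<lambda>c p vs. 0"

definition ext_deriv :: "('m, 'n::finite) chart set \<Rightarrow> ('m, 'n) form \<Rightarrow> ('m, 'n) form" where
  "ext_deriv A \<omega> = (\<lambda>c p vs. if c \<in> A \<and> p \<in> cdom c then
     (\<Sum>i<length vs. (-1) ^ i *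
        frechet_derivative (\<lambda>x. \<omega> c (cinv c x) (take i vs @ drop (Suc i) vs))
          (at (cmap c p) within cimg c) (vs ! i))
     else 0)"

section \<open>Vector fields and the Lie derivative\<close>

type_synonym ('m, 'n) vfield = "('m, 'n) chart \<Rightarrow> 'm \<Rightarrow> real ^ 'n"

definition vector_field :: "('m, 'n::finite) chart set \<Rightarrow> ('m, 'n) vfield \<Rightarrow> bool" where
  "vector_field A \<xi> \<longleftrightarrow>
     (\<forall>c\<in>A. smooth_rel (cimg c) (\<lambda>x. \<xi> c (cinv c x))) \<and>
     (\<forall>c\<in>A. \<forall>c'\<in>A. \<forall>p\<in>cdom c \<inter> cdom c'. \<xi> c' p = trans_deriv c c' p (\<xi> c p))"

definition compactly_supported_interior ::
    "'m topology \<Rightarrow> ('m, 'n::{finite, linorder}) chart set \<Rightarrow> ('m, 'n) vfield \<Rightarrow> bool" where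
  "compactly_supported_interior X A \<xi> \<longleftrightarrow>
     (\<exists>K. compactin X K \<and> K \<subseteq> topspace X - bdry A \<and> (\<forall>c\<in>A. \<forall>p\<in>cdom c - K. \<xi> c p = 0))"

text \<open>This is \<open>(L\<^sub>\<xi> \<omega>)(v\<^sub>1,\<dots>,v\<^sub>k) = \<xi>(\<omega>(v\<^sub>1,\<dots>,v\<^sub>k)) - (\<Sum>i. \<omega>(v\<^sub>1,\<dots>,[\<xi>,v\<^sub>i],\<dots>,v\<^sub>k))\<close> on fields \<open>v\<^sub>i\<close> that
  are constant in the chart, for which \<open>[\<xi>,v\<^sub>i]\<close> is minus the derivative of \<open>\<xi>\<close> in direction \<open>v\<^sub>i\<close>.\<close>

definition lie_deriv ::
    "('m, 'n::finite) chart set \<Rightarrow> ('m, 'n) vfield \<Rightarrow> ('m, 'n) form \<Rightarrow> ('m, 'n) form" where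
  "lie_deriv A \<xi> \<omega> = (\<lambda>c p vs. if c \<in> A \<and> p \<in> cdom c then
     frechet_derivative (\<lambda>x. \<omega> c (cinv c x) vs) (at (cmap c p) within cimg c) (\<xi> c p) +
     (\<Sum>i<length vs. \<omega> c p (vs[i :=
        frechet_derivative (\<lambda>x. \<xi> c (cinv c x)) (at (cmap c p) within cimg c) (vs ! i)]))
     else 0)"

section \<open>Riemannian metrics\<close>

type_synonym ('m, 'n) metric = "('m, 'n) chart \<Rightarrow> 'm \<Rightarrow> real ^ 'n \<Rightarrow> real ^ 'n \<Rightarrow> real"

definition riemannian_metric :: "('m, 'n::finite) chart set \<Rightarrow> ('m, 'n) metric \<Rightarrow> bool" where
  "riemannian_metric A g \<longleftrightarrow>
     (\<forall>c\<in>A. \<forall>p\<in>cdom c. bilinear (g c p) \<and> (\<forall>u v. g c p u v = g c p v u) \<and>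
        (\<forall>v. v \<noteq> 0 \<longrightarrow> g c p v v > 0)) \<and>
     (\<forall>c\<in>A. \<forall>u v. smooth_rel (cimg c) (\<lambda>x. g c (cinv c x) u v)) \<and>
     (\<forall>c\<in>A. \<forall>c'\<in>A. \<forall>p\<in>cdom c \<inter> cdom c'. \<forall>u v.
        g c p u v = g c' p (trans_deriv c c' p u) (trans_deriv c c' p v))"

definition gram :: "('m, 'n::finite) metric \<Rightarrow> ('m, 'n) chart \<Rightarrow> 'm \<Rightarrow> real ^ 'n ^ 'n" where
  "gram g c p = (\<chi> i j. g c p (axis i 1) (axis j 1))"

text \<open>The inner product of \<open>k\<close>-forms, \<open>1/k! g\<^sup>i\<^sup>j \<cdots> g\<^sup>l\<^sup>m \<omega>\<^bsub>i\<dots>l\<^esub> \<eta>\<^bsub>j\<dots>m\<^esub>\<close>. The sums are over all multi-indices, so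
  that with the factor \<open>1/k!\<close> the wedge products of an orthonormal coframe are orthonormal.\<close>

definition form_inner ::
    "nat \<Rightarrow> ('m, 'n::finite) metric \<Rightarrow> ('m, 'n) form \<Rightarrow> ('m, 'n) form \<Rightarrow> ('m, 'n) chart \<Rightarrow> 'm \<Rightarrow> real" where
  "form_inner k g \<omega> \<eta> c p =
     (\<Sum>I\<in>{I::'n list. length I = k}. \<Sum>J\<in>{J::'n list. length J = k}.
        (\<Prod>a<k. matrix_inv (gram g c p) $ (I ! a) $ (J ! a)) *
        \<omega> c p (map (\<lambda>i. axis i 1) I) * \<eta> c p (map (\<lambda>j. axis j 1) J)) / fact k"

definition form_norm ::
    "nat \<Rightarrow> ('m, 'n::finite) metric \<Rightarrow> ('m, 'n) form \<Rightarrow> ('m, 'n) chart \<Rightarrow> 'm \<Rightarrow> real" where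
  "form_norm k g \<omega> c p = sqrt (form_inner k g \<omega> \<omega> c p)"

definition coord_pos :: "'n::{finite, linorder} \<Rightarrow> nat" where
  "coord_pos i = card {j. j < i}"

text \<open>The volume form \<open>sqrt (det g) dx\<^sub>1 \<and> \<cdots> \<and> dx\<^sub>n\<close> (the charts are positively oriented).\<close>

definition vol_form :: "('m, 'n::{finite, linorder}) metric \<Rightarrow> ('m, 'n) form" where
  "vol_form g c p vs = (if length vs = CARD('n)
     then sqrt (det (gram g c p)) * det (\<chi> i. vs ! coord_pos i) else 0)"

section \<open>Integration of top-degree forms\<close>

definition std_frame :: "(real ^ 'n::{finite, linorder}) list" where
  "std_frame = map (\<lambda>i. axis i 1) (sorted_list_of_set UNIV)"

definition partition_of_unity ::
    "'m topology \<Rightarrow> ('m, 'n) chart set \<Rightarrow> ('m, 'n) chart set \<Rightarrow> (('m, 'n) chart \<Rightarrow> 'm \<Rightarrow> real) \<Rightarrow> bool" where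
  "partition_of_unity X A C \<rho> \<longleftrightarrow>
     finite C \<and> C \<subseteq> A \<and>
     (\<forall>c\<in>C. continuous_map X euclideanreal (\<rho> c) \<and> (\<forall>p\<in>topspace X. \<rho> c p \<ge> 0) \<and>
        X closure_of {p \<in> topspace X. \<rho> c p \<noteq> 0} \<subseteq> cdom c) \<and>
     (\<forall>p\<in>topspace X. (\<Sum>c\<in>C. \<rho> c p) = 1)"

text \<open>The integral over a compact oriented manifold. It does not depend on the partition of unity
  that is chosen; merely continuous ones suffice for integration.\<close>

definition mfd_integral :: "'m topology \<Rightarrow> ('m, 'n::{finite, linorder}) chart set \<Rightarrow> ('m, 'n) form \<Rightarrow> real" where
  "mfd_integral X A \<omega> =
     (case (SOME (C, \<rho>). partition_of_unity X A C \<rho>) of (C, \<rho>) \<Rightarrow>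
        \<Sum>c\<in>C. LINT x:cimg c|lborel. \<rho> c (cinv c x) * \<omega> c (cinv c x) std_frame)"

definition L2_norm_squared ::
    "'m topology \<Rightarrow> ('m, 'n::{finite, linorder}) chart set \<Rightarrow> nat \<Rightarrow> ('m, 'n) metric \<Rightarrow> ('m, 'n) form \<Rightarrow> real" where
  "L2_norm_squared X A k g \<gamma> =
     mfd_integral X A (\<lambda>c p vs. (form_norm k g \<gamma> c p)\<^sup>2 * vol_form g c p vs)"

definition L1_norm ::
    "'m topology \<Rightarrow> ('m, 'n::{finite, linorder}) chart set \<Rightarrow> nat \<Rightarrow> ('m, 'n) metric \<Rightarrow> ('m, 'n) form \<Rightarrow> real" where
  "L1_norm X A k g \<gamma> = mfd_integral X A (\<lambda>c p vs. form_norm k g \<gamma> c p * vol_form g c p vs)"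

section \<open>Stationary points\<close>

definition stationary_point ::
    "(('m, 'n) form \<Rightarrow> real) \<Rightarrow> ('m, 'n) form set \<Rightarrow> ('m, 'n) form \<Rightarrow> bool" where
  "stationary_point F V \<beta> \<longleftrightarrow>
     (\<forall>\<gamma>\<in>V. ((\<lambda>t. F (\<lambda>c p vs. \<beta> c p vs + t * \<gamma> c p vs)) has_real_derivative 0) (at 0))"

definition variations_closed ::
    "'m topology \<Rightarrow> ('m, 'n::{finite, linorder}) chart set \<Rightarrow> ('m, 'n) form set" where
  "variations_closed X A =
     {\<gamma> \<in> Omega X A (CARD('n) - 1). ext_deriv A \<gamma> = zero_form \<and> bdry_pullback A \<gamma> = zero_form}"

definition variations_exact ::
    "'m topology \<Rightarrow> ('m, 'n::{finite, linorder}) chart set \<Rightarrow> ('m, 'n) form set" where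
  "variations_exact X A =
     {ext_deriv A \<alpha> | \<alpha>. \<alpha> \<in> Omega X A (CARD('n) - 2) \<and> bdry_pullback A \<alpha> = zero_form}"

definition variations_lie ::
    "'m topology \<Rightarrow> ('m, 'n::{finite, linorder}) chart set \<Rightarrow> ('m, 'n) form \<Rightarrow> ('m, 'n) form set" where
  "variations_lie X A \<beta> =
     {(\<lambda>c p vs. - lie_deriv A \<xi> \<beta> c p vs) | \<xi>.
        vector_field A \<xi> \<and> compactly_supported_interior X A \<xi>}"

end

theory Submission
  imports Defs
begin

text \<open>
  Both functionals have the same first variation, up to a factor 2. Write \<open>f = |\<beta>|\<close> for the norm with
  respect to the given metric \<open>g\<close>, and let \<open>h = f\<^sup>2 g\<close>. Norms of \<open>(n - 1)\<close>-forms scale with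
  \<open>f\<close> to the power \<open>-(n - 1)\<close> and volume forms with \<open>f\<close> to the power \<open>n\<close>, so that the \<open>L\<^sup>1\<close>-density
  with respect to \<open>h\<close> is \<open>f |\<gamma>| \<mu>\<close>, where \<open>|\<gamma>|\<close> and \<open>\<mu>\<close> belong to \<open>g\<close> (\<open>conformal_density\<close>). Put
  \<open>a = \<langle>\<beta>, \<beta>\<rangle>\<close>, \<open>b = \<langle>\<beta>, \<gamma>\<rangle>\<close> and \<open>e = \<langle>\<gamma>, \<gamma>\<rangle>\<close>. Along \<open>\<beta> + t\<gamma>\<close> the two densities are
  \<open>a + 2tb + t\<^sup>2e\<close> for the squared \<open>L\<^sup>2\<close>-norm and \<open>\<surd>a \<surd>(a + 2tb + t\<^sup>2e)\<close> for the \<open>L\<^sup>1\<close>-norm, times \<open>\<mu>\<close>.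
  If \<open>D\<close> is the integral of \<open>b \<mu>\<close>, the derivatives at \<open>t = 0\<close> are \<open>2D\<close> and \<open>D\<close>
  (\<open>first_variations\<close>), and hence vanish together, for each \<open>\<gamma>\<close> separately.

  To differentiate the second one under the integral, no domination argument is needed: by the inequalities of
  Cauchy-Schwarz and of the arithmetic and geometric mean,
  \<open>a + tb \<le> \<surd>a \<surd>(a + 2tb + t\<^sup>2e) \<le> a + tb + t\<^sup>2e/2\<close>
  for every \<open>t\<close> (\<open>sqrt_product_bounds\<close>), so that after integration the remainder is quadratic in \<open>t\<close>.

  The rest makes these integrals meaningful. Cauchy-Schwarz for forms needs the inner product on
  \<open>k\<close>-forms to be positive semidefinite, which is shown from a factorization of the Gram matrix
  (\<open>cholesky\<close>, \<open>tensor_power_nonneg\<close>). The integral over the manifold is the sum of chart integrals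
  weighted by a partition of unity, which exists on a compact Hausdorff space
  (\<open>partition_of_unity_exists\<close>). The weighted densities are integrable because they are continuous with compact support in
  the chart image (\<open>chart_integrable\<close>); in all three classes the variations have continuous
  coefficients, because exterior and Lie derivatives of smooth forms do
  (\<open>variations_continuous_coeffs\<close>).
\<close>

section \<open>Quadratic remainders and the two model integrals\<close>

text \<open>The lower bound follows from \<open>(a + tb)\<^sup>2 \<le> a (a + 2tb + t\<^sup>2e)\<close>, whose two sides differ by \<open>t\<^sup>2(ae - b\<^sup>2)\<close>. The
  upper bound is the inequality of the arithmetic and geometric mean for the two radicands. The bounds hold for
  all \<open>t\<close>, also where the radicand vanishes and the square root is not differentiable.\<close>

lemma sqrt_product_bounds:
  fixes a b e t :: real
  assumes "a \<ge> 0" "b\<^sup>2 \<le> a * e" "a + 2 * t * b + t\<^sup>2 * e \<ge> 0"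
  shows "a + t * b \<le> sqrt a * sqrt (a + 2 * t * b + t\<^sup>2 * e)"
    and "sqrt a * sqrt (a + 2 * t * b + t\<^sup>2 * e) \<le> a + t * b + t\<^sup>2 * e / 2"
proof -
  let ?s = "a + 2 * t * b + t\<^sup>2 * e"
  have "(a + t * b)\<^sup>2 \<le> a * ?s"
  proof -
    have "a * ?s - (a + t * b)\<^sup>2 = t\<^sup>2 * (a * e - b\<^sup>2)"
      by (simp add: power2_eq_square algebra_simps)
    moreover have "0 \<le> t\<^sup>2 * (a * e - b\<^sup>2)"
      using assms(2) by simp
    ultimately show ?thesis by linarith
  qed
  then show "a + t * b \<le> sqrt a * sqrt ?s"
    by (metis real_le_rsqrt real_sqrt_mult)
  have "sqrt (a * ?s) \<le> (a + ?s) / 2"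
    using arith_geo_mean_sqrt[OF assms(1,3)] by simp
  also have "\<dots> = a + t * b + t\<^sup>2 * e / 2"
    by (simp add: field_simps)
  finally show "sqrt a * sqrt ?s \<le> a + t * b + t\<^sup>2 * e / 2"
    by (simp only: real_sqrt_mult)
qed

lemma has_derivative_of_quadratic_remainder:
  fixes F :: "real \<Rightarrow> real"
  assumes "\<And>t. \<bar>F t - F 0 - t * D\<bar> \<le> C * t\<^sup>2"
  shows "(F has_real_derivative D) (at 0)"
proof -
  have "((\<lambda>h. (F (0 + h) - F 0) / h - D) \<longlongrightarrow> 0) (at 0)"
  proof (rule Lim_null_comparison)
    show "\<forall>\<^sub>F h in at 0. norm ((F (0 + h) - F 0) / h - D) \<le> C * \<bar>h\<bar>"
      unfolding eventually_at_filter
    proof (intro always_eventually allI impI)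
      fix h :: real assume h: "h \<noteq> 0"
      have "(F (0 + h) - F 0) / h - D = (F h - F 0 - h * D) / h"
        using h by (simp add: field_simps)
      also have "norm \<dots> \<le> C * h\<^sup>2 / \<bar>h\<bar>"
        using assms[of h] h by (simp add: divide_right_mono)
      also have "\<dots> = C * \<bar>h\<bar>"
        using h by (simp add: power2_eq_square abs_if)
      finally show "norm ((F (0 + h) - F 0) / h - D) \<le> C * \<bar>h\<bar>" .
    qed
    have "((\<lambda>h. C * \<bar>h\<bar>) \<longlongrightarrow> C * \<bar>0\<bar>) (at (0::real))"
      by (intro tendsto_intros)
    then show "((\<lambda>h. C * \<bar>h\<bar>) \<longlongrightarrow> 0) (at (0::real))"
      by simp
  qed
  then show ?thesis
    unfolding DERIV_def using LIM_zero_iff by blast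
qed

lemma derivative_integral_quadratic:
  fixes w a b e :: "'a \<Rightarrow> real"
  assumes "set_integrable M S (\<lambda>x. w x * a x)" "set_integrable M S (\<lambda>x. w x * b x)"
    "set_integrable M S (\<lambda>x. w x * e x)"
  shows "((\<lambda>t. LINT x:S|M. w x * (a x + 2 * t * b x + t\<^sup>2 * e x))
           has_real_derivative 2 * (LINT x:S|M. w x * b x)) (at 0)"
proof -
  have "(LINT x:S|M. w x * (a x + 2 * t * b x + t\<^sup>2 * e x)) =
      (LINT x:S|M. w x * a x) + 2 * t * (LINT x:S|M. w x * b x) + t\<^sup>2 * (LINT x:S|M. w x * e x)" for t
  proof -
    have "(LINT x:S|M. w x * (a x + 2 * t * b x + t\<^sup>2 * e x)) =
        (LINT x:S|M. w x * a x + 2 * t * (w x * b x) + t\<^sup>2 * (w x * e x))"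
      by (simp add: algebra_simps)
    also have "\<dots> = (LINT x:S|M. w x * a x) + (LINT x:S|M. 2 * t * (w x * b x)) + (LINT x:S|M. t\<^sup>2 * (w x * e x))"
      using assms by (subst set_integral_add; (intro set_integral_add set_integrable_mult_right)?; simp)
    finally show ?thesis by simp
  qed
  moreover have "((\<lambda>t. A + 2 * t * B + t\<^sup>2 * E) has_real_derivative 2 * B) (at 0)" for A B E :: real
    by (auto intro!: derivative_eq_intros)
  ultimately show ?thesis by simp
qed

text \<open>The remainder of the integrand is at most \<open>t\<^sup>2|w e|/2\<close>, so the quadratic remainder passes
  through the integral. The weight \<open>w\<close> may have either sign.\<close>

lemma derivative_integral_weighted_sqrt:
  fixes w a b e :: "'a \<Rightarrow> real"
  assumes S: "S \<in> sets M"
    and int: "set_integrable M S (\<lambda>x. w x * a x)" "set_integrable M S (\<lambda>x. w x * b x)"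
    "set_integrable M S (\<lambda>x. w x * e x)"
    "\<And>t. set_integrable M S (\<lambda>x. w x * (sqrt (a x) * sqrt (a x + 2 * t * b x + t\<^sup>2 * e x)))"
    and a: "\<And>x. x \<in> S \<Longrightarrow> a x \<ge> 0"
    and cs: "\<And>x. x \<in> S \<Longrightarrow> (b x)\<^sup>2 \<le> a x * e x"
    and nonneg: "\<And>x t. x \<in> S \<Longrightarrow> a x + 2 * t * b x + t\<^sup>2 * e x \<ge> 0"
  shows "((\<lambda>t. LINT x:S|M. w x * (sqrt (a x) * sqrt (a x + 2 * t * b x + t\<^sup>2 * e x)))
           has_real_derivative (LINT x:S|M. w x * b x)) (at 0)"
    (is "(?F has_real_derivative _) _")
proof (rule has_derivative_of_quadratic_remainder)
  fix t :: real
  let ?q = "\<lambda>x. sqrt (a x) * sqrt (a x + 2 * t * b x + t\<^sup>2 * e x)"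
  have F0: "?F 0 = (LINT x:S|M. w x * a x)"
    using a by (intro set_lebesgue_integral_cong[OF S]) auto
  have i1: "set_integrable M S (\<lambda>x. t * (w x * b x))"
    using int(2) by simp
  have i2: "set_integrable M S (\<lambda>x. w x * ?q x - w x * a x - t * (w x * b x))"
    by (intro set_integral_diff(1) int i1)
  have i3: "set_integrable M S (\<lambda>x. t\<^sup>2 / 2 * \<bar>w x * e x\<bar>)"
    using int(3) by (intro set_integrable_mult_right set_integrable_abs)
  have eq: "?F t - ?F 0 - t * (LINT x:S|M. w x * b x) = (LINT x:S|M. w x * ?q x - w x * a x - t * (w x * b x))"
    unfolding F0 using int i1
    by (simp add: set_integral_diff)
  have "\<bar>LINT x:S|M. w x * ?q x - w x * a x - t * (w x * b x)\<bar>
      \<le> (LINT x:S|M. \<bar>w x * ?q x - w x * a x - t * (w x * b x)\<bar>)"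
    using set_integral_norm_bound[OF i2] by simp
  moreover have "(LINT x:S|M. \<bar>w x * ?q x - w x * a x - t * (w x * b x)\<bar>)
      \<le> (LINT x:S|M. t\<^sup>2 / 2 * \<bar>w x * e x\<bar>)"
  proof (rule set_integral_mono[OF set_integrable_abs[OF i2] i3])
    fix x assume x: "x \<in> S"
    note bd = sqrt_product_bounds[OF a[OF x] cs[OF x] nonneg[OF x, of t]]
    have "\<bar>?q x - a x - t * b x\<bar> \<le> t\<^sup>2 / 2 * \<bar>e x\<bar>"
    proof -
      have "t\<^sup>2 * e x \<le> t\<^sup>2 * \<bar>e x\<bar>"
        by (intro mult_left_mono) auto
      with bd show ?thesis by linarith
    qed
    then have "\<bar>w x\<bar> * \<bar>?q x - a x - t * b x\<bar> \<le> \<bar>w x\<bar> * (t\<^sup>2 / 2 * \<bar>e x\<bar>)"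
      by (intro mult_left_mono) auto
    moreover have "\<bar>w x\<bar> * \<bar>?q x - a x - t * b x\<bar> = \<bar>w x * ?q x - w x * a x - t * (w x * b x)\<bar>"
      unfolding abs_mult[symmetric] by (rule arg_cong[where f = abs]) (simp only: algebra_simps)
    moreover have "\<bar>w x\<bar> * (t\<^sup>2 / 2 * \<bar>e x\<bar>) = t\<^sup>2 / 2 * \<bar>w x * e x\<bar>"
      by (simp add: abs_mult)
    ultimately show "\<bar>w x * ?q x - w x * a x - t * (w x * b x)\<bar> \<le> t\<^sup>2 / 2 * \<bar>w x * e x\<bar>"
      by (simp only:)
  qed
  ultimately show "\<bar>?F t - ?F 0 - t * (LINT x:S|M. w x * b x)\<bar> \<le> (LINT x:S|M. \<bar>w x * e x\<bar>) / 2 * t\<^sup>2"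
    unfolding eq by (simp add: mult.commute)
qed

section \<open>Positive definite matrices and their tensor powers\<close>

text \<open>Completing the square in one coordinate \<open>s\<close> splits off the square of a linear form and leaves the
  Schur complement on the other coordinates. The complement is positive definite again: its value at \<open>x\<close> is that of
  the whole form at the extension of \<open>x\<close> whose coordinate \<open>s\<close> minimizes it.\<close>

lemma cholesky:
  fixes G :: "'n \<Rightarrow> 'n \<Rightarrow> real"
  assumes "finite S"
    and "\<And>i j. i \<in> S \<Longrightarrow> j \<in> S \<Longrightarrow> G i j = G j i"
    and "\<And>x. \<exists>i\<in>S. x i \<noteq> 0 \<Longrightarrow> (\<Sum>i\<in>S. \<Sum>j\<in>S. x i * G i j * x j) > 0"
  shows "\<exists>L. \<forall>i\<in>S. \<forall>j\<in>S. G i j = (\<Sum>l\<in>S. L l i * L l j)"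
  using assms
proof (induction S arbitrary: G rule: finite_induct)
  case empty
  then show ?case by simp
next
  case (insert s S)
  have pos: "G s s > 0"
  proof -
    \<comment> \<open>a diagonal entry is the value of the form at a unit vector\<close>
    let ?x = "\<lambda>i. if i = s then 1 else 0 :: real"
    have z: "(\<Sum>j\<in>S. ?x i * G i j * ?x j) = 0" for i
      using insert.hyps by (intro sum.neutral) auto
    have z': "(\<Sum>i\<in>S. \<Sum>j\<in>insert s S. ?x i * G i j * ?x j) = 0"
      using insert.hyps by (intro sum.neutral) auto
    have "(\<Sum>i\<in>insert s S. \<Sum>j\<in>insert s S. ?x i * G i j * ?x j) =
        (\<Sum>j\<in>insert s S. ?x s * G s j * ?x j)"
      by (subst sum.insert[OF insert.hyps]) (simp only: z' add_0_right)
    also have "\<dots> = G s s"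
      by (subst sum.insert[OF insert.hyps]) (simp only: z, simp)
    finally have "(\<Sum>i\<in>insert s S. \<Sum>j\<in>insert s S. ?x i * G i j * ?x j) = G s s" .
    moreover have "0 < (\<Sum>i\<in>insert s S. \<Sum>j\<in>insert s S. ?x i * G i j * ?x j)"
      by (rule insert.prems(2)) auto
    ultimately show ?thesis by linarith
  qed
  \<comment> \<open>the Schur complement\<close>
  define H where "H i j = G i j - G i s * G s j / G s s" for i j
  have sym: "G i j = G j i" if "i \<in> insert s S" "j \<in> insert s S" for i j
    using insert.prems(1) that by blast
  have "\<exists>L. \<forall>i\<in>S. \<forall>j\<in>S. H i j = (\<Sum>l\<in>S. L l i * L l j)"
  proof (rule insert.IH)
    fix i j assume "i \<in> S" "j \<in> S"
    then show "H i j = H j i"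
      unfolding H_def using sym[of i j] sym[of s i] sym[of s j] by simp
  next
    fix x :: "'n \<Rightarrow> real" assume x: "\<exists>i\<in>S. x i \<noteq> 0"
    define m where "m = (\<Sum>j\<in>S. G s j * x j)"
    \<comment> \<open>the minimizer in the coordinate \<open>s\<close> with the other coordinates given by \<open>x\<close>\<close>
    define y where "y = x(s := - m / G s s)"
    have y: "y i = x i" if "i \<in> S" for i
      using that insert.hyps by (auto simp: y_def)
    have m': "(\<Sum>i\<in>S. x i * G i s) = m"
      unfolding m_def using sym by (intro sum.cong) auto
    have "0 < (\<Sum>i\<in>insert s S. \<Sum>j\<in>insert s S. y i * G i j * y j)"
      using x y by (intro insert.prems(2)) force
    also have "\<dots> = y s * G s s * y s + (\<Sum>j\<in>S. y s * G s j * x j) + (\<Sum>i\<in>S. x i * G i s * y s)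
        + (\<Sum>i\<in>S. \<Sum>j\<in>S. x i * G i j * x j)"
      using insert.hyps y by (simp add: sum.distrib)
    also have "(\<Sum>j\<in>S. y s * G s j * x j) = y s * m"
      unfolding m_def by (simp add: sum_distrib_left mult.assoc)
    also have "(\<Sum>i\<in>S. x i * G i s * y s) = m * y s"
      unfolding m'[symmetric] by (simp add: sum_distrib_right)
    also have "y s * G s s * y s + y s * m + m * y s + (\<Sum>i\<in>S. \<Sum>j\<in>S. x i * G i j * x j) =
        (\<Sum>i\<in>S. \<Sum>j\<in>S. x i * G i j * x j) - m * m / G s s"
      using pos by (simp add: y_def field_simps)
    also have "\<dots> = (\<Sum>i\<in>S. \<Sum>j\<in>S. x i * H i j * x j)"
    proof -
      have "m * m / G s s = (\<Sum>i\<in>S. \<Sum>j\<in>S. x i * G i s * (G s j * x j)) / G s s"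
        unfolding sum_product[symmetric] m' by (simp add: m_def)
      also have "\<dots> = (\<Sum>i\<in>S. \<Sum>j\<in>S. x i * (G i s * G s j / G s s) * x j)"
        by (simp add: sum_divide_distrib algebra_simps)
      finally show ?thesis
        by (simp add: H_def algebra_simps sum_subtractf)
    qed
    finally show "0 < (\<Sum>i\<in>S. \<Sum>j\<in>S. x i * H i j * x j)" .
  qed
  then obtain L where L: "\<And>i j. i \<in> S \<Longrightarrow> j \<in> S \<Longrightarrow> H i j = (\<Sum>l\<in>S. L l i * L l j)"
    by blast
  define K where "K l i = (if l = s then G s i / sqrt (G s s) else if i = s then 0 else L l i)" for l i
  have Ks: "K s i * K s j = G s i * G s j / G s s" for i j
    using pos by (simp add: K_def)
  show ?case
  proof (intro exI ballI)
    fix i j assume ij: "i \<in> insert s S" "j \<in> insert s S"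
    have "(\<Sum>l\<in>insert s S. K l i * K l j) = G s i * G s j / G s s + (\<Sum>l\<in>S. K l i * K l j)"
      using insert.hyps by (simp add: Ks)
    also have "\<dots> = G i j"
    proof (cases "i = s \<or> j = s")
      case True
      have "(\<Sum>l\<in>S. K l i * K l j) = 0"
        using True insert.hyps by (intro sum.neutral) (auto simp: K_def)
      then show ?thesis
        using True pos sym[OF ij] sym[of s i] ij by auto
    next
      case False
      then have mem: "i \<in> S" "j \<in> S" using ij by auto
      have "(\<Sum>l\<in>S. K l i * K l j) = (\<Sum>l\<in>S. L l i * L l j)"
        using False insert.hyps by (intro sum.cong) (auto simp: K_def)
      then show ?thesis
        using L[OF mem] sym[of s i] mem by (simp add: H_def)
    qed
    finally show "G i j = (\<Sum>l\<in>insert s S. K l i * K l j)" by simp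
  qed
qed

lemma matrix_inv_eqI:
  fixes A B :: "real ^ 'n::finite ^ 'n"
  assumes "A ** B = mat 1"
  shows "matrix_inv A = B"
proof -
  have BA: "B ** A = mat 1" using assms by (simp add: matrix_left_right_inverse)
  have ex: "\<exists>A'. A ** A' = mat 1 \<and> A' ** A = mat 1" using assms BA by blast
  have "matrix_inv A ** A = mat 1"
    unfolding matrix_inv_def using someI_ex[OF ex] by simp
  then have "matrix_inv A ** (A ** B) = B"
    by (metis matrix_mul_assoc matrix_mul_lid)
  then show ?thesis using assms by simp
qed

text \<open>The factorization \<open>M M\<^sup>T\<close> makes the inverse a sum of squares, the form in which
  positivity passes to tensor powers.\<close>

lemma inverse_of_positive_definite:
  fixes G :: "real ^ 'n::finite ^ 'n"
  assumes sym: "\<And>i j. G $ i $ j = G $ j $ i"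
    and pos: "\<And>x. x \<noteq> 0 \<Longrightarrow> x \<bullet> (G *v x) > 0"
  obtains M :: "real ^ 'n ^ 'n" where "matrix_inv G = M ** transpose M" and "det G > 0"
proof -
  have "\<exists>L::'n \<Rightarrow> 'n \<Rightarrow> real. \<forall>i\<in>UNIV. \<forall>j\<in>UNIV. G $ i $ j = (\<Sum>l\<in>UNIV. L l i * L l j)"
  proof (rule cholesky[of UNIV "\<lambda>i j. G $ i $ j"])
    fix x :: "'n \<Rightarrow> real" assume "\<exists>i\<in>UNIV. x i \<noteq> 0"
    then have "(\<chi> i. x i) \<noteq> 0" by (auto simp: vec_eq_iff)
    from pos[OF this] show "0 < (\<Sum>i\<in>UNIV. \<Sum>j\<in>UNIV. x i * G $ i $ j * x j)"
      by (simp add: inner_vec_def matrix_vector_mult_def sum_distrib_left mult.assoc)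
  qed (use sym in auto)
  then obtain l where l: "\<And>i j. G $ i $ j = (\<Sum>k\<in>(UNIV::'n set). l k i * l k j)" by blast
  define L :: "real ^ 'n ^ 'n" where "L = (\<chi> k i. l k i)"
  have G: "G = transpose L ** L"
    by (simp add: vec_eq_iff matrix_matrix_mult_def transpose_def L_def l)
  have "L *v x \<noteq> 0" if "x \<noteq> 0" for x
    using pos[OF that] unfolding G by (auto simp: matrix_vector_mul_assoc[symmetric])
  then obtain M where left: "M ** L = mat 1"
    using matrix_left_invertible_ker[of L] by blast
  then have right: "L ** M = mat 1" by (simp add: matrix_left_right_inverse)
  have "G ** (M ** transpose M) = transpose L ** (L ** M) ** transpose M"
    by (simp add: G matrix_mul_assoc)
  also have "\<dots> = transpose (M ** L)"
    by (simp add: right matrix_transpose_mul)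
  also have "\<dots> = mat 1" by (simp add: left)
  finally have inverse: "matrix_inv G = M ** transpose M" by (rule matrix_inv_eqI)
  have "det L \<noteq> 0"
    using right by (metis det_I det_mul mult_zero_left zero_neq_one)
  then have "det G > 0" by (metis G det_mul det_transpose not_real_square_gt_zero)
  with inverse that show thesis by blast
qed

lemma matrix_inv_scaleR:
  fixes G :: "real ^ 'n::finite ^ 'n"
  assumes "det G \<noteq> 0" "s \<noteq> 0"
  shows "matrix_inv (s *\<^sub>R G) = inverse s *\<^sub>R matrix_inv G"
proof -
  obtain B where B: "G ** B = mat 1"
    using assms(1) invertible_det_nz[of G] by (auto simp: invertible_def)
  have "(s *\<^sub>R G) ** (inverse s *\<^sub>R B) = mat 1"
    using assms(2) unfolding B[symmetric] by (simp add: vec_eq_iff matrix_matrix_mult_def field_simps)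
  then show ?thesis using matrix_inv_eqI B by metis
qed

lemma det_scaleR:
  fixes G :: "real ^ 'n::finite ^ 'n"
  shows "det (s *\<^sub>R G) = s ^ CARD('n) * det G"
  by (simp add: det_def prod.distrib sum_distrib_left algebra_simps)

lemma continuous_on_det_entries:
  fixes G :: "'a::topological_space \<Rightarrow> real ^ 'n::finite ^ 'n"
  assumes "\<And>i j. continuous_on S (\<lambda>x. G x $ i $ j)"
  shows "continuous_on S (\<lambda>x. det (G x))"
  unfolding det_def
  by (intro continuous_on_sum continuous_on_mult continuous_on_prod continuous_on_const assms)

text \<open>By the rule of Cramer the entries of the inverse are quotients of determinants.\<close>

lemma continuous_on_matrix_inv_entry:
  fixes G :: "'a::topological_space \<Rightarrow> real ^ 'n::finite ^ 'n"
  assumes cont: "\<And>i j. continuous_on S (\<lambda>x. G x $ i $ j)"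
    and det: "\<And>x. x \<in> S \<Longrightarrow> det (G x) \<noteq> 0"
  shows "continuous_on S (\<lambda>x. matrix_inv (G x) $ k $ j)"
proof -
  let ?C = "\<lambda>x. (\<chi> i l. if l = k then axis j 1 $ i else G x $ i $ l) :: real ^ 'n ^ 'n"
  have eq: "matrix_inv (G x) $ k $ j = det (?C x) / det (G x)" if x: "x \<in> S" for x
  proof -
    obtain B where B: "G x ** B = mat 1"
      using det[OF x] invertible_det_nz[of "G x"] by (auto simp: invertible_def)
    have "G x *v (B *v axis j 1) = axis j 1"
      by (simp add: matrix_vector_mul_assoc B)
    then have "B *v axis j 1 = (\<chi> k. det (\<chi> i l. if l = k then axis j 1 $ i else G x $ i $ l) / det (G x))"
      using cramer[OF det[OF x], of "B *v axis j 1" "axis j 1"] by blast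
    then have "(B *v axis j 1) $ k = det (?C x) / det (G x)"
      by simp
    then show ?thesis
      by (simp add: matrix_inv_eqI[OF B] matrix_vector_mult_basis column_def)
  qed
  have "continuous_on S (\<lambda>x. ?C x $ i $ l)" for i l
    by (cases "l = k") (simp_all add: cont)
  then have "continuous_on S (\<lambda>x. det (?C x) / det (G x))"
    using det by (intro continuous_on_divide continuous_on_det_entries cont) auto
  then show ?thesis using eq by (simp cong: continuous_on_cong)
qed

lemma sum_lists_Suc:
  fixes f :: "'n::finite list \<Rightarrow> 'b::comm_monoid_add"
  shows "(\<Sum>I\<in>{I. length I = Suc k}. f I) = (\<Sum>i\<in>UNIV. \<Sum>I\<in>{I. length I = k}. f (i # I))"
proof -
  have "{I. length I = Suc k} = (\<lambda>(i, I). i # I) ` (UNIV \<times> {I::'n list. length I = k})"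
    by (auto simp: length_Suc_conv image_iff)
  moreover have "inj_on (\<lambda>(i, I). i # I) (UNIV \<times> {I::'n list. length I = k})"
    by (auto simp: inj_on_def)
  ultimately show ?thesis
    by (simp add: sum.reindex sum.cartesian_product case_prod_unfold)
qed

text \<open>The summation index \<open>l\<close> of the factorization moves to the front, past the indices of both arguments.\<close>

lemma sum_reorder:
  "(\<Sum>i\<in>A. \<Sum>I\<in>B. \<Sum>j\<in>A. \<Sum>J\<in>B. \<Sum>l\<in>A. f i I j J l) =
   (\<Sum>l\<in>A. \<Sum>I\<in>B. \<Sum>J\<in>B. \<Sum>i\<in>A. \<Sum>j\<in>A. f i I j J l)" (is "?lhs = ?rhs")
proof -
  have "?lhs = (\<Sum>I\<in>B. \<Sum>i\<in>A. \<Sum>j\<in>A. \<Sum>J\<in>B. \<Sum>l\<in>A. f i I j J l)"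
    by (rule sum.swap)
  also have "\<dots> = (\<Sum>I\<in>B. \<Sum>i\<in>A. \<Sum>J\<in>B. \<Sum>j\<in>A. \<Sum>l\<in>A. f i I j J l)"
    by (rule sum.cong[OF refl], rule sum.cong[OF refl], rule sum.swap)
  also have "\<dots> = (\<Sum>I\<in>B. \<Sum>J\<in>B. \<Sum>i\<in>A. \<Sum>j\<in>A. \<Sum>l\<in>A. f i I j J l)"
    by (rule sum.cong[OF refl], rule sum.swap)
  also have "\<dots> = (\<Sum>I\<in>B. \<Sum>J\<in>B. \<Sum>i\<in>A. \<Sum>l\<in>A. \<Sum>j\<in>A. f i I j J l)"
    by (rule sum.cong[OF refl], rule sum.cong[OF refl], rule sum.cong[OF refl], rule sum.swap)
  also have "\<dots> = (\<Sum>I\<in>B. \<Sum>J\<in>B. \<Sum>l\<in>A. \<Sum>i\<in>A. \<Sum>j\<in>A. f i I j J l)"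
    by (rule sum.cong[OF refl], rule sum.cong[OF refl], rule sum.swap)
  also have "\<dots> = (\<Sum>I\<in>B. \<Sum>l\<in>A. \<Sum>J\<in>B. \<Sum>i\<in>A. \<Sum>j\<in>A. f i I j J l)"
    by (rule sum.cong[OF refl], rule sum.swap)
  also have "\<dots> = (\<Sum>l\<in>A. \<Sum>I\<in>B. \<Sum>J\<in>B. \<Sum>i\<in>A. \<Sum>j\<in>A. f i I j J l)"
    by (rule sum.swap)
  finally show ?thesis .
qed

text \<open>Writing the first factor of the power \<open>k + 1\<close> as a sum of squares, over \<open>l\<close>, turns the value at \<open>u\<close> into the sum over \<open>l\<close>
  of the values of the \<open>k\<close>-th power at contractions of \<open>u\<close> in its first index.\<close>

lemma tensor_power_nonneg:
  fixes M :: "real ^ 'n::finite ^ 'n" and u :: "'n list \<Rightarrow> real"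
  shows "0 \<le> (\<Sum>I\<in>{I. length I = k}. \<Sum>J\<in>{J. length J = k}.
              (\<Prod>a<k. (M ** transpose M) $ (I ! a) $ (J ! a)) * u I * u J)"
proof (induction k arbitrary: u)
  case 0
  then show ?case by simp
next
  case (Suc k)
  let ?H = "M ** transpose M" and ?Ls = "{I::'n list. length I = k}"
  let ?P = "\<lambda>I J. \<Prod>a<k. ?H $ (I ! a) $ (J ! a)"
  let ?v = "\<lambda>l I. \<Sum>i\<in>UNIV. M $ i $ l * u (i # I)"
  have H: "?H $ i $ j = (\<Sum>l\<in>UNIV. M $ i $ l * M $ j $ l)" for i j
    by (simp add: matrix_matrix_mult_def transpose_def)
  have "(\<Sum>I\<in>{I. length I = Suc k}. \<Sum>J\<in>{J. length J = Suc k}.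
              (\<Prod>a<Suc k. ?H $ (I ! a) $ (J ! a)) * u I * u J) =
     (\<Sum>i\<in>UNIV. \<Sum>I\<in>?Ls. \<Sum>j\<in>UNIV. \<Sum>J\<in>?Ls. ?H $ i $ j * ?P I J * u (i # I) * u (j # J))"
    by (simp add: sum_lists_Suc prod.lessThan_Suc_shift del: prod.lessThan_Suc)
  also have "\<dots> = (\<Sum>i\<in>UNIV. \<Sum>I\<in>?Ls. \<Sum>j\<in>UNIV. \<Sum>J\<in>?Ls. \<Sum>l\<in>UNIV.
       ?P I J * (M $ i $ l * u (i # I)) * (M $ j $ l * u (j # J)))"
    unfolding H by (simp add: sum_distrib_right sum_distrib_left algebra_simps)
  also have "\<dots> = (\<Sum>l\<in>UNIV. \<Sum>I\<in>?Ls. \<Sum>J\<in>?Ls. \<Sum>i\<in>UNIV. \<Sum>j\<in>UNIV.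
       ?P I J * (M $ i $ l * u (i # I)) * (M $ j $ l * u (j # J)))"
    by (rule sum_reorder)
  also have "\<dots> = (\<Sum>l\<in>UNIV. \<Sum>I\<in>?Ls. \<Sum>J\<in>?Ls. ?P I J * ?v l I * ?v l J)"
    by (simp only: mult.assoc sum_product) (simp only: sum_distrib_left mult.assoc)
  also have "\<dots> \<ge> 0"
    by (intro sum_nonneg Suc.IH)
  finally show ?case .
qed

section \<open>Smooth functions on the half space\<close>

lemma continuous_on_locally:
  fixes f :: "'a::t2_space \<Rightarrow> 'b::topological_space"
  assumes "\<And>x. x \<in> S \<Longrightarrow> \<exists>W g. open W \<and> x \<in> W \<and> continuous_on W g \<and> (\<forall>y\<in>S \<inter> W. g y = f y)"
  shows "continuous_on S f"
  unfolding continuous_on_eq_continuous_within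
proof
  fix x assume x: "x \<in> S"
  then obtain W g where W: "open W" "x \<in> W" "continuous_on W g" "\<And>y. y \<in> S \<inter> W \<Longrightarrow> g y = f y"
    using assms by meson
  have "continuous_on (S \<inter> W) g"
    using W(3) continuous_on_subset by blast
  then have "continuous_on (S \<inter> W) f"
    using W(4) continuous_on_cong[of "S \<inter> W" "S \<inter> W" g f] by blast
  then have "continuous (at x within S \<inter> W) f"
    using x W(2) by (simp add: continuous_on_eq_continuous_within)
  moreover have "at x within S \<inter> W = at x within S"
    using W by (intro at_within_nhd[of x W]) auto
  ultimately show "continuous (at x within S) f" by simp
qed

lemma smooth_rel_imp_continuous_on:
  assumes "smooth_rel S f"
  shows "continuous_on S f"
proof (rule continuous_on_locally)
  fix x assume "x \<in> S"
  then obtain W g where W: "open W" "x \<in> W" "\<And>k. ck_on k W g" "\<forall>y\<in>S \<inter> W. g y = f y"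
    using assms unfolding smooth_rel_def by meson
  moreover have "continuous_on W g" using W(3)[of 0] by simp
  ultimately show "\<exists>W g. open W \<and> x \<in> W \<and> continuous_on W g \<and> (\<forall>y\<in>S \<inter> W. g y = f y)"
    by blast
qed

text \<open>A relatively open set contains, with each point, a short segment in every positive coordinate
  direction, also at the boundary hyperplane. This is what makes derivatives within such sets unique.\<close>

lemma half_space_direction:
  fixes S :: "(real ^ 'n::{finite, linorder}) set"
  assumes "openin (top_of_set half_space) S" "x \<in> S" "i \<in> Basis" "e > 0"
  shows "\<exists>d. 0 < \<bar>d\<bar> \<and> \<bar>d\<bar> < e \<and> x + d *\<^sub>R i \<in> S"
proof -
  obtain T where T: "open T" "S = half_space \<inter> T"
    using assms(1) by (auto simp: openin_open)
  then obtain r where r: "r > 0" "ball x r \<subseteq> T"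
    using assms(2) openE by blast
  obtain k where k: "i = axis k 1"
    using assms(3) by (auto simp: Basis_vec_def)
  let ?d = "min (e / 2) (r / 2)"
  have d: "?d > 0" "?d < e" "?d < r" using assms(4) r(1) by auto
  have "x + ?d *\<^sub>R i \<in> ball x r"
    using d assms(3) by (simp add: dist_norm)
  moreover have "x + ?d *\<^sub>R i \<in> half_space"
    using assms(2) T(2) d(1) k by (auto simp: half_space_def axis_def)
  ultimately show ?thesis
    using d r T(2) by (intro exI[of _ ?d]) auto
qed

lemma frechet_derivative_within_half_space:
  fixes S :: "(real ^ 'n::{finite, linorder}) set" and f :: "real ^ 'n::{finite, linorder} \<Rightarrow> 'b::real_normed_vector"
  assumes S: "openin (top_of_set half_space) S" and x: "x \<in> S"
    and W: "open W" "x \<in> W" and g: "g differentiable at x" and eq: "\<And>y. y \<in> S \<inter> W \<Longrightarrow> g y = f y"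
  shows "(f has_derivative frechet_derivative g (at x)) (at x within S)"
    and "frechet_derivative f (at x within S) = frechet_derivative g (at x)"
proof -
  obtain r where r: "r > 0" "ball x r \<subseteq> W" using W openE by blast
  have "(g has_derivative frechet_derivative g (at x)) (at x within S)"
    using g frechet_derivative_works has_derivative_at_withinI by blast
  then show *: "(f has_derivative frechet_derivative g (at x)) (at x within S)"
    by (rule has_derivative_transform_within[OF _ r(1) x])
       (metis IntI dist_commute eq mem_ball r(2) subsetD)
  then have "(f has_derivative frechet_derivative f (at x within S)) (at x within S)"
    using differentiableI frechet_derivative_works by blast
  then show "frechet_derivative f (at x within S) = frechet_derivative g (at x)"
    using * half_space_direction[OF S x] by (rule frechet_derivative_unique_within)
qed

text \<open>Both properties are local, and locally the derivative is that of a smooth extension to an open set.\<close>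

lemma smooth_rel_derivative:
  fixes S :: "(real ^ 'n::{finite, linorder}) set" and f :: "real ^ 'n::{finite, linorder} \<Rightarrow> 'b::real_normed_vector"
  assumes S: "openin (top_of_set half_space) S" and f: "smooth_rel S f"
  shows continuous_on_frechet_derivative: "continuous_on S (\<lambda>x. frechet_derivative f (at x within S) v)"
    and linear_frechet_derivative_within: "x \<in> S \<Longrightarrow> linear (frechet_derivative f (at x within S))"
proof -
  have loc: "\<exists>W g. open W \<and> x \<in> W \<and> (\<forall>k. ck_on k W g) \<and> (\<forall>y\<in>S \<inter> W. g y = f y)" if "x \<in> S" for x
    using f that unfolding smooth_rel_def by blast
  show "continuous_on S (\<lambda>x. frechet_derivative f (at x within S) v)"
  proof (rule continuous_on_locally)
    fix x assume "x \<in> S"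
    then obtain W g where W: "open W" "x \<in> W" "\<And>k. ck_on k W g" "\<And>y. y \<in> S \<inter> W \<Longrightarrow> g y = f y"
      using loc by meson
    have g: "\<And>y. y \<in> W \<Longrightarrow> g differentiable at y" "continuous_on W (\<lambda>y. frechet_derivative g (at y) v)"
      using W(3)[of "Suc 0"] by auto
    have "frechet_derivative g (at y) v = frechet_derivative f (at y within S) v" if "y \<in> S \<inter> W" for y
      using frechet_derivative_within_half_space(2)[OF S _ W(1) _ g(1) W(4)] that by auto
    with W(1,2) g(2) show "\<exists>W g. open W \<and> x \<in> W \<and> continuous_on W g \<and>
        (\<forall>y\<in>S \<inter> W. g y = frechet_derivative f (at y within S) v)"
      by (intro exI[of _ W] exI[of _ "\<lambda>y. frechet_derivative g (at y) v"]) auto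
  qed
  show "linear (frechet_derivative f (at x within S))" if x: "x \<in> S"
  proof -
    obtain W g where W: "open W" "x \<in> W" "\<And>k. ck_on k W g" "\<And>y. y \<in> S \<inter> W \<Longrightarrow> g y = f y"
      using loc[OF x] by meson
    have g: "g differentiable at x" using W(2) W(3)[of "Suc 0"] by auto
    show ?thesis
      using frechet_derivative_within_half_space[OF S x W(1,2) g W(4)] has_derivative_linear by simp
  qed
qed

lemma linear_coordinates:
  fixes f :: "real ^ 'n::finite \<Rightarrow> 'b::real_vector"
  assumes "linear f"
  shows "f v = (\<Sum>i\<in>UNIV. v $ i *\<^sub>R f (axis i 1))"
proof -
  have "v = (\<Sum>i\<in>UNIV. v $ i *\<^sub>R axis i 1)"
    using basis_expansion[of v] by (simp add: scalar_mult_eq_scaleR)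
  then have "f v = f (\<Sum>i\<in>UNIV. v $ i *\<^sub>R axis i 1)" by simp
  then show ?thesis by (simp add: linear_sum[OF assms] linear_scale[OF assms])
qed

section \<open>Charts, partitions of unity and integrals\<close>

lemma chart_facts:
  assumes "smooth_atlas X A" "c \<in> A"
  shows chart_domain_subset: "cdom c \<subseteq> topspace X"
    and chart_image_openin: "openin (top_of_set half_space) (cimg c)"
    and cinv_cmap: "\<And>p. p \<in> cdom c \<Longrightarrow> cinv c (cmap c p) = p"
    and cmap_cinv: "\<And>x. x \<in> cimg c \<Longrightarrow> cmap c (cinv c x) = x"
    and cinv_in_domain: "\<And>x. x \<in> cimg c \<Longrightarrow> cinv c x \<in> cdom c"
    and chart_continuous: "continuous_map (subtopology X (cdom c)) (top_of_set (cimg c)) (cmap c)"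
    and chart_inverse_continuous: "continuous_map (top_of_set (cimg c)) (subtopology X (cdom c)) (cinv c)"
proof -
  have *: "openin X (cdom c)"
    "homeomorphic_map (subtopology X (cdom c)) (top_of_set (cimg c)) (cmap c)"
    using assms unfolding smooth_atlas_def by blast+
  show "openin (top_of_set half_space) (cimg c)"
    using assms unfolding smooth_atlas_def by blast
  show sub: "cdom c \<subseteq> topspace X" using * openin_subset by blast
  then have top: "topspace (subtopology X (cdom c)) = cdom c" by auto
  show "continuous_map (subtopology X (cdom c)) (top_of_set (cimg c)) (cmap c)"
    using * homeomorphic_imp_continuous_map by blast
  obtain h where h: "homeomorphic_maps (subtopology X (cdom c)) (top_of_set (cimg c)) (cmap c) h"
    using *(2) homeomorphic_map_maps by blast
  then have hp: "h (cmap c p) = p" if "p \<in> cdom c" for p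
    using that top by (auto simp: homeomorphic_maps_def)
  then have inj: "inj_on (cmap c) (cdom c)" by (metis inj_onI)
  show cc: "cinv c (cmap c p) = p" if "p \<in> cdom c" for p
    using that inj by (simp add: cinv_def)
  show "cmap c (cinv c x) = x" "cinv c x \<in> cdom c" if "x \<in> cimg c" for x
    using that by (auto simp: cc)
  have "h x = cinv c x" if "x \<in> topspace (top_of_set (cimg c))" for x
    using that by (auto simp: cc hp)
  then show "continuous_map (top_of_set (cimg c)) (subtopology X (cdom c)) (cinv c)"
    using h unfolding homeomorphic_maps_def by (metis (no_types, lifting) continuous_map_eq)
qed

lemma chart_image_borel:
  assumes "smooth_atlas X A" "c \<in> A"
  shows "cimg c \<in> sets borel"
proof -
  obtain T where T: "open T" "cimg c = half_space \<inter> T"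
    using chart_image_openin[OF assms] by (auto simp: openin_open)
  have "closed half_space"
    unfolding half_space_def by (intro closed_Collect_le continuous_intros)
  then show ?thesis unfolding T(2) by (intro sets.Int borel_closed borel_open T(1))
qed

text \<open>The integrand is continuous and vanishes outside the image of the support of \<open>r\<close>, which is compact
  because the support is compact and contained in the domain of the chart.\<close>

lemma chart_integrable:
  assumes A: "smooth_atlas X A" "c \<in> A" and X: "compact_space X"
    and r: "continuous_map X euclideanreal r" "X closure_of {p \<in> topspace X. r p \<noteq> 0} \<subseteq> cdom c"
    and h: "continuous_on (cimg c) h"
  shows "set_integrable lborel (cimg c) (\<lambda>x. r (cinv c x) * h x)"
proof -
  let ?supp = "X closure_of {p \<in> topspace X. r p \<noteq> 0}"
  let ?K = "cmap c ` ?supp" and ?f = "\<lambda>x. r (cinv c x) * h x"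
  have "compactin X ?supp"
    using X by (simp add: closedin_compact_space)
  then have "compactin (subtopology X (cdom c)) ?supp"
    using r(2) by (simp add: compactin_subtopology)
  then have "compactin (top_of_set (cimg c)) ?K"
    using chart_continuous[OF A] image_compactin by blast
  then have K: "compact ?K" "?K \<subseteq> cimg c"
    by (auto simp: compactin_subtopology)
  have "continuous_map (top_of_set (cimg c)) euclideanreal (r \<circ> cinv c)"
    using chart_inverse_continuous[OF A] r(1)
    by (meson continuous_map_compose continuous_map_in_subtopology)
  then have "continuous_on (cimg c) ?f"
    using h by (auto simp: comp_def intro: continuous_on_mult)
  then have "integrable lborel (\<lambda>x. indicator ?K x *\<^sub>R ?f x)"
    using K continuous_on_subset by (intro borel_integrable_compact) blast+
  moreover have "indicator ?K x *\<^sub>R ?f x = indicator (cimg c) x *\<^sub>R ?f x" for x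
  proof (cases "x \<in> cimg c \<and> x \<notin> ?K")
    case True
    then have "cinv c x \<notin> ?supp"
      using cmap_cinv[OF A, of x] by (metis imageI)
    moreover have "cinv c x \<in> topspace X"
      using True cinv_in_domain[OF A] chart_domain_subset[OF A] by blast
    ultimately have "r (cinv c x) = 0"
      using closure_of_subset[of "{p \<in> topspace X. r p \<noteq> 0}" X] by auto
    then show ?thesis by simp
  next
    case False
    then show ?thesis using K(2) by (auto simp: indicator_def)
  qed
  ultimately show ?thesis by (simp only: set_integrable_def)
qed

text \<open>Around each point there is a bump function supported in a chart. Finitely many of them have a
  positive sum, those that are supported in the same chart are added up, and the results are divided by the sum.\<close>

lemma partition_of_unity_exists:
  assumes X: "compact_space X" "Hausdorff_space X" and A: "smooth_atlas X A"
  obtains C \<rho> where "partition_of_unity X A C \<rho>"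
proof -
  have normal: "normal_space X"
    using X compact_Hausdorff_or_regular_imp_normal_space by blast
  define bump where "bump c f p \<longleftrightarrow> c \<in> A \<and> continuous_map X euclideanreal f \<and>
      (\<forall>q\<in>topspace X. f q \<ge> 0) \<and> f p > 0 \<and> X closure_of {q \<in> topspace X. f q \<noteq> 0} \<subseteq> cdom c"
    for c f p
  have "\<exists>c f. bump c f p" if p: "p \<in> topspace X" for p
  proof -
    obtain c where c: "c \<in> A" "p \<in> cdom c" "openin X (cdom c)"
      using A p unfolding smooth_atlas_def by blast
    have cl: "closedin X {p}"
      using p X(2) by (simp add: closedin_Hausdorff_singleton)
    then obtain U where U: "openin X U" "p \<in> U" "X closure_of U \<subseteq> cdom c"
      using normal c unfolding normal_space_alt by (metis empty_subsetI insert_subset)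
    have "closedin X (topspace X - U)" "disjnt (topspace X - U) {p}"
      using U by (auto simp: disjnt_def)
    then obtain f where f: "continuous_map X (top_of_set {0..1::real}) f"
        "f ` (topspace X - U) \<subseteq> {0}" "f ` {p} \<subseteq> {1}"
      using Urysohn_lemma[OF normal _ cl, of "topspace X - U" 0 1] by auto
    have "{q \<in> topspace X. f q \<noteq> 0} \<subseteq> U" using f(2) by auto
    then have "X closure_of {q \<in> topspace X. f q \<noteq> 0} \<subseteq> cdom c"
      using U(3) closure_of_mono by blast
    moreover have "f q \<ge> 0" if "q \<in> topspace X" for q
      using f(1) that by (auto simp: continuous_map_in_subtopology)
    ultimately show ?thesis
      unfolding bump_def using c(1) f(1,3) by (intro exI[of _ c] exI[of _ f]) (auto simp: continuous_map_in_subtopology)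
  qed
  then obtain c f where "\<And>p. p \<in> topspace X \<Longrightarrow> bump (c p) (f p) p"
    by metis
  then have fA: "\<And>p. p \<in> topspace X \<Longrightarrow> c p \<in> A"
    and fcont: "\<And>p. p \<in> topspace X \<Longrightarrow> continuous_map X euclideanreal (f p)"
    and fnn: "\<And>p q. p \<in> topspace X \<Longrightarrow> q \<in> topspace X \<Longrightarrow> f p q \<ge> 0"
    and fpos: "\<And>p. p \<in> topspace X \<Longrightarrow> f p p > 0"
    and fsupp: "\<And>p. p \<in> topspace X \<Longrightarrow> X closure_of {q \<in> topspace X. f p q \<noteq> 0} \<subseteq> cdom (c p)"
    unfolding bump_def by simp_all
  let ?U = "\<lambda>p. {q \<in> topspace X. f p q > 0}"
  have opn: "openin X (?U p)" if "p \<in> topspace X" for p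
    using openin_continuous_map_preimage[OF fcont[OF that], of "{0<..}"] by simp
  have cover: "topspace X \<subseteq> \<Union>(?U ` topspace X)"
    using fpos by fastforce
  have "\<exists>\<F>. finite \<F> \<and> \<F> \<subseteq> ?U ` topspace X \<and> topspace X \<subseteq> \<Union>\<F>"
    by (rule compactinD[OF _ _ cover]) (use X(1) opn in \<open>auto simp: compact_space_def\<close>)
  then obtain \<F> where F: "finite \<F>" "\<F> \<subseteq> ?U ` topspace X" "topspace X \<subseteq> \<Union>\<F>"
    by blast
  obtain P where P': "P \<subseteq> topspace X" "finite P" "\<F> = ?U ` P"
    using finite_subset_image[OF F(1,2)] by blast
  have P: "finite P" "P \<subseteq> topspace X" "topspace X \<subseteq> (\<Union>p\<in>P. ?U p)"
    using P' F(3) by simp_all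
  have PX: "p \<in> topspace X" if "p \<in> P" for p
    using that P(2) by blast
  define s where "s q = (\<Sum>p\<in>P. f p q)" for q
  define \<rho> where "\<rho> d q = (\<Sum>p\<in>{p\<in>P. c p = d}. f p q) / s q" for d q
  have spos: "s q > 0" if q: "q \<in> topspace X" for q
  proof -
    obtain p where p: "p \<in> P" "f p q > 0" using P(3) q by auto
    show ?thesis
      unfolding s_def using p P(1) fnn PX q by (intro sum_pos2[of P p]) auto
  qed
  have "partition_of_unity X A (c ` P) \<rho>"
    unfolding partition_of_unity_def
  proof (intro conjI ballI)
    show "finite (c ` P)" "c ` P \<subseteq> A" using P(1) fA PX by auto
  next
    fix d
    have "continuous_map X euclideanreal s"
      unfolding s_def using P(1) fcont PX by (intro continuous_map_sum) auto
    moreover have "continuous_map X euclideanreal (\<lambda>q. \<Sum>p\<in>{p\<in>P. c p = d}. f p q)"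
      using P(1) fcont PX by (intro continuous_map_sum) auto
    ultimately show "continuous_map X euclideanreal (\<rho> d)"
      unfolding \<rho>_def using spos by (intro continuous_map_real_divide) (auto simp: less_imp_neq[symmetric])
  next
    fix d q assume "q \<in> topspace X"
    then show "\<rho> d q \<ge> 0"
      unfolding \<rho>_def using spos[of q] fnn PX by (intro divide_nonneg_pos sum_nonneg) auto
  next
    fix d
    have "{q \<in> topspace X. \<rho> d q \<noteq> 0} \<subseteq> (\<Union>p\<in>{p\<in>P. c p = d}. {q \<in> topspace X. f p q \<noteq> 0})"
    proof
      fix q assume q: "q \<in> {q \<in> topspace X. \<rho> d q \<noteq> 0}"
      then have "(\<Sum>p\<in>{p\<in>P. c p = d}. f p q) \<noteq> 0" by (auto simp: \<rho>_def)
      then obtain p where "p \<in> {p\<in>P. c p = d}" "f p q \<noteq> 0"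
        by (rule sum.not_neutral_contains_not_neutral)
      with q show "q \<in> (\<Union>p\<in>{p\<in>P. c p = d}. {q \<in> topspace X. f p q \<noteq> 0})" by blast
    qed
    then have "X closure_of {q \<in> topspace X. \<rho> d q \<noteq> 0} \<subseteq>
        X closure_of (\<Union>p\<in>{p\<in>P. c p = d}. {q \<in> topspace X. f p q \<noteq> 0})"
      by (rule closure_of_mono)
    also have "\<dots> = (\<Union>p\<in>{p\<in>P. c p = d}. X closure_of {q \<in> topspace X. f p q \<noteq> 0})"
      using P(1) by (subst closure_of_Union) auto
    also have "\<dots> \<subseteq> cdom d" using PX fsupp by auto
    finally show "X closure_of {q \<in> topspace X. \<rho> d q \<noteq> 0} \<subseteq> cdom d" .
  next
    fix q assume q: "q \<in> topspace X"
    have "(\<Sum>d\<in>c ` P. \<Sum>p\<in>{p\<in>P. c p = d}. f p q) = s q"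
      unfolding s_def using P(1) by (rule sum.image_gen[symmetric])
    then show "(\<Sum>d\<in>c ` P. \<rho> d q) = 1"
      using spos[OF q] by (simp add: \<rho>_def sum_divide_distrib[symmetric])
  qed
  then show thesis by (rule that)
qed

text \<open>The integral is defined through a chosen partition of unity; existence guarantees that the choice is one.\<close>

lemma mfd_integral_formula:
  fixes X :: "'m topology" and A :: "('m, 'n::{finite, linorder}) chart set"
  assumes "compact_space X" "Hausdorff_space X" "smooth_atlas X A"
  obtains C \<rho> where "partition_of_unity X A C \<rho>"
    and "\<And>\<omega>. mfd_integral X A \<omega> =
      (\<Sum>c\<in>C. LINT x:cimg c|lborel. \<rho> c (cinv c x) * \<omega> c (cinv c x) std_frame)"
proof -
  obtain C' \<rho>' where "partition_of_unity X A C' \<rho>'"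
    using partition_of_unity_exists[OF assms] .
  then have *: "case (C', \<rho>') of (C, \<rho>) \<Rightarrow> partition_of_unity X A C \<rho>" by simp
  obtain C \<rho> where C: "(SOME (C, \<rho>). partition_of_unity X A C \<rho>) = (C, \<rho>)"
    by fastforce
  then have "partition_of_unity X A C \<rho>"
    using someI[of "\<lambda>(C, \<rho>). partition_of_unity X A C \<rho>", OF *] by simp
  then show thesis using that[of C \<rho>] by (simp add: mfd_integral_def C)
qed

section \<open>Continuity of the coefficients of forms\<close>

text \<open>The regularity on which the integrability of the densities rests; smooth forms and their exterior and
  Lie derivatives share it.\<close>

definition continuous_coeffs :: "('m, 'n::{finite, linorder}) chart set \<Rightarrow> nat \<Rightarrow> ('m, 'n) form \<Rightarrow> bool" where
  "continuous_coeffs A k \<omega> \<longleftrightarrow>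
     (\<forall>c\<in>A. \<forall>I. length I = k \<longrightarrow>
        continuous_on (cimg c) (\<lambda>x. \<omega> c (cinv c x) (map (\<lambda>i. axis i 1) I)))"

lemma smooth_rel_form_coefficient:
  assumes A: "smooth_atlas X A" "c \<in> A" and \<omega>: "\<omega> \<in> Omega X A k"
  shows "smooth_rel (cimg c) (\<lambda>x. \<omega> c (cinv c x) vs)"
proof -
  have "smooth_rel (cmap c ` (cdom c \<inter> topspace X)) (\<lambda>x. \<omega> c (cinv c x) vs)"
    using \<omega> A(2) unfolding Omega_def forms_on_def by blast
  moreover have "cdom c \<inter> topspace X = cdom c"
    using chart_domain_subset[OF A] by blast
  ultimately show ?thesis by simp
qed

lemma continuous_coeffs_Omega:
  assumes "smooth_atlas X A" "\<omega> \<in> Omega X A k"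
  shows "continuous_coeffs A k' \<omega>"
  unfolding continuous_coeffs_def
  using smooth_rel_imp_continuous_on smooth_rel_form_coefficient assms by blast

lemma continuous_coeffs_ext_deriv:
  fixes A :: "('m, 'n::{finite, linorder}) chart set"
  assumes A: "smooth_atlas X A" and \<alpha>: "\<alpha> \<in> Omega X A k"
  shows "continuous_coeffs A k' (ext_deriv A \<alpha>)"
  unfolding continuous_coeffs_def
proof (intro ballI allI impI)
  fix c and I :: "'n list" assume c: "c \<in> A"
  let ?vs = "map (\<lambda>i. axis i 1) I :: (real, 'n) vec list"
  let ?D = "\<lambda>x. \<Sum>i<length ?vs. (-1) ^ i *
    frechet_derivative (\<lambda>x. \<alpha> c (cinv c x) (take i ?vs @ drop (Suc i) ?vs)) (at x within cimg c) (?vs ! i)"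
  have "continuous_on (cimg c) ?D"
    by (intro continuous_on_sum continuous_on_mult continuous_on_const
        continuous_on_frechet_derivative chart_image_openin[OF A c] smooth_rel_form_coefficient[OF A c \<alpha>])
  moreover have "?D x = ext_deriv A \<alpha> c (cinv c x) ?vs" if "x \<in> cimg c" for x
    using c that by (simp add: ext_deriv_def cinv_in_domain[OF A c] cmap_cinv[OF A c])
  ultimately show "continuous_on (cimg c) (\<lambda>x. ext_deriv A \<alpha> c (cinv c x) ?vs)"
    by (rule continuous_on_eq)
qed

lemma alternating_on_linear_slot:
  assumes "alternating_on UNIV k f" "length vs = k" "i < k"
  shows "linear (\<lambda>w. f (vs[i := w]))"
proof -
  have *: "f (vs[i := a *\<^sub>R u + b *\<^sub>R v]) = a * f (vs[i := u]) + b * f (vs[i := v])" for u v a b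
    using assms unfolding alternating_on_def by blast
  show ?thesis
    using *[of 1 _ 1] *[of _ _ 0 0] by (intro linearI) simp_all
qed

text \<open>The Lie derivative evaluates derivatives and forms at vectors that vary with the point. Expanding these
  vectors in coordinates leaves finitely many products of continuous functions.\<close>

lemma continuous_coeffs_lie_deriv:
  fixes A :: "('m, 'n::{finite, linorder}) chart set"
  assumes A: "smooth_atlas X A" and \<beta>: "\<beta> \<in> Omega X A k" and \<xi>: "vector_field A \<xi>"
  shows "continuous_coeffs A k (lie_deriv A \<xi> \<beta>)"
  unfolding continuous_coeffs_def
proof (intro ballI allI impI)
  fix c and I :: "'n list" assume c: "c \<in> A" and I: "length I = k"
  let ?ax = "\<lambda>i. axis i 1 :: (real, 'n) vec"
  let ?vs = "map ?ax I" and ?S = "cimg c"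
  let ?D\<beta> = "\<lambda>x. frechet_derivative (\<lambda>x. \<beta> c (cinv c x) ?vs) (at x within ?S)"
  let ?D\<xi> = "\<lambda>x. frechet_derivative (\<lambda>x. \<xi> c (cinv c x)) (at x within ?S)"
  note op = chart_image_openin[OF A c]
  note sm = smooth_rel_form_coefficient[OF A c \<beta>]
  have sm\<xi>: "smooth_rel ?S (\<lambda>x. \<xi> c (cinv c x))"
    using \<xi> c unfolding vector_field_def by blast
  let ?L = "\<lambda>x. (\<Sum>j\<in>UNIV. \<xi> c (cinv c x) $ j * ?D\<beta> x (?ax j)) +
     (\<Sum>i<k. \<Sum>j\<in>UNIV. ?D\<xi> x (?vs ! i) $ j * \<beta> c (cinv c x) (map ?ax (I[i := j])))"
  have "continuous_on ?S ?L"
    by (intro continuous_on_add continuous_on_sum continuous_on_mult continuous_on_component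
        continuous_on_frechet_derivative op sm sm\<xi> smooth_rel_imp_continuous_on)
  moreover have "?L x = lie_deriv A \<xi> \<beta> c (cinv c x) ?vs" if x: "x \<in> ?S" for x
  proof -
    have dom: "cinv c x \<in> cdom c" and x': "cmap c (cinv c x) = x"
      using x cinv_in_domain[OF A c] cmap_cinv[OF A c] by blast+
    have alt: "alternating_on UNIV k (\<beta> c (cinv c x))"
    proof -
      have "if c \<in> A \<and> cinv c x \<in> cdom c \<inter> topspace X then alternating_on UNIV k (\<beta> c (cinv c x))
          else \<beta> c (cinv c x) = (\<lambda>_. 0)"
        using \<beta> unfolding Omega_def forms_on_def by blast
      then show ?thesis using c dom chart_domain_subset[OF A c] by (auto split: if_splits)
    qed
    have "?D\<beta> x (\<xi> c (cinv c x)) = (\<Sum>j\<in>UNIV. \<xi> c (cinv c x) $ j * ?D\<beta> x (?ax j))"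
      using linear_coordinates[OF linear_frechet_derivative_within[OF op sm[of ?vs] x], of "\<xi> c (cinv c x)"]
      by simp
    moreover have "\<beta> c (cinv c x) (?vs[i := w]) = (\<Sum>j\<in>UNIV. w $ j * \<beta> c (cinv c x) (map ?ax (I[i := j])))"
      if "i < k" for i w
    proof -
      have "linear (\<lambda>w. \<beta> c (cinv c x) (?vs[i := w]))"
        using alternating_on_linear_slot[OF alt _ that] I by simp
      from linear_coordinates[OF this, of w] show ?thesis
        by (simp add: map_update)
    qed
    ultimately show ?thesis
      using c dom x' I by (simp add: lie_deriv_def)
  qed
  ultimately show "continuous_on ?S (\<lambda>x. lie_deriv A \<xi> \<beta> c (cinv c x) ?vs)"
    by (rule continuous_on_eq)
qed

lemma variations_continuous_coeffs:
  fixes A :: "('m, 'n::{finite, linorder}) chart set"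
  assumes A: "smooth_atlas X A" and \<beta>: "\<beta> \<in> Omega X A (CARD('n) - 1)"
    and V: "V \<in> {variations_closed X A, variations_exact X A, variations_lie X A \<beta>}" and \<gamma>: "\<gamma> \<in> V"
  shows "continuous_coeffs A (CARD('n) - 1) \<gamma>"
proof -
  consider "\<gamma> \<in> variations_closed X A" | "\<gamma> \<in> variations_exact X A" | "\<gamma> \<in> variations_lie X A \<beta>"
    using V \<gamma> by blast
  then show ?thesis
  proof cases
    case 1
    then show ?thesis
      using continuous_coeffs_Omega[OF A] unfolding variations_closed_def by blast
  next
    case 2
    then show ?thesis
      using continuous_coeffs_ext_deriv[OF A] unfolding variations_exact_def by blast
  next
    case 3
    then obtain \<xi> where \<xi>: "vector_field A \<xi>" "\<gamma> = (\<lambda>c p vs. - lie_deriv A \<xi> \<beta> c p vs)"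
      unfolding variations_lie_def by blast
    have "continuous_coeffs A (CARD('n) - 1) (lie_deriv A \<xi> \<beta>)"
      by (rule continuous_coeffs_lie_deriv[OF A \<beta> \<xi>(1)])
    then show ?thesis
      unfolding \<xi>(2) continuous_coeffs_def by (simp add: continuous_on_minus)
  qed
qed

section \<open>The inner product of forms\<close>

lemma gram_inverse:
  fixes g :: "('m, 'n::finite) metric"
  assumes "riemannian_metric A g" "c \<in> A" "p \<in> cdom c"
  obtains M :: "((real, 'n) vec, 'n) vec" where "matrix_inv (gram g c p) = M ** transpose M" "det (gram g c p) > 0"
proof -
  have g: "bilinear (g c p)" "\<And>u v. g c p u v = g c p v u" "\<And>v. v \<noteq> 0 \<Longrightarrow> g c p v v > 0"
    using assms unfolding riemannian_metric_def by blast+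
  have sym: "gram g c p $ i $ j = gram g c p $ j $ i" for i j
    using g(2) by (simp add: gram_def)
  have l: "linear (\<lambda>u. g c p u v)" "linear (g c p v)" for v
    using g(1) by (auto simp: bilinear_def)
  have "g c p x x = x \<bullet> (gram g c p *v x)" for x
  proof -
    have right: "g c p u x = (\<Sum>j\<in>UNIV. x $ j * g c p u (axis j 1))" for u
      using linear_coordinates[OF l(2)[of u], of x] by simp
    have "g c p x x = (\<Sum>i\<in>UNIV. x $ i * g c p (axis i 1) x)"
      using linear_coordinates[OF l(1)[of x], of x] by simp
    also have "\<dots> = (\<Sum>i\<in>UNIV. x $ i * (\<Sum>j\<in>UNIV. x $ j * g c p (axis i 1) (axis j 1)))"
      by (simp only: right)
    finally show ?thesis
      by (simp add: inner_vec_def matrix_vector_mult_def gram_def mult.commute)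
  qed
  then have pos: "x \<bullet> (gram g c p *v x) > 0" if "x \<noteq> 0" for x
    using g(3)[OF that] by simp
  show thesis
    by (rule inverse_of_positive_definite[OF sym pos]) (use that in blast)+
qed

lemma form_inner_commute:
  assumes "\<And>i j. matrix_inv (gram g c p) $ i $ j = matrix_inv (gram g c p) $ j $ i"
  shows "form_inner k g \<omega> \<eta> c p = form_inner k g \<eta> \<omega> c p"
  unfolding form_inner_def
  by (subst sum.swap) (simp add: assms[of "_ ! _" "_ ! _"] mult.commute mult.left_commute)

lemma form_inner_linear_left:
  "form_inner k g (\<lambda>c p vs. x * \<omega> c p vs + y * \<eta> c p vs) \<theta> c p =
     x * form_inner k g \<omega> \<theta> c p + y * form_inner k g \<eta> \<theta> c p"
  unfolding form_inner_def
  by (simp add: sum.distrib sum_distrib_left sum_distrib_right add_divide_distrib algebra_simps)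

lemma form_inner_square:
  assumes "\<And>i j. matrix_inv (gram g c p) $ i $ j = matrix_inv (gram g c p) $ j $ i"
  defines "\<sigma> \<equiv> \<lambda>\<omega> \<eta> x y. (\<lambda>c p vs. x * \<omega> c p vs + y * \<eta> c p vs)"
  shows "form_inner k g (\<sigma> \<omega> \<eta> x y) (\<sigma> \<omega> \<eta> x y) c p =
     x\<^sup>2 * form_inner k g \<omega> \<omega> c p + 2 * x * y * form_inner k g \<omega> \<eta> c p + y\<^sup>2 * form_inner k g \<eta> \<eta> c p"
proof -
  note comm = form_inner_commute[OF assms(1)]
  have "form_inner k g (\<sigma> \<omega> \<eta> x y) (\<sigma> \<omega> \<eta> x y) c p =
      x * form_inner k g (\<sigma> \<omega> \<eta> x y) \<omega> c p + y * form_inner k g (\<sigma> \<omega> \<eta> x y) \<eta> c p"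
    unfolding \<sigma>_def by (subst form_inner_linear_left) (simp only: comm)
  also have "\<dots> = x * (x * form_inner k g \<omega> \<omega> c p + y * form_inner k g \<eta> \<omega> c p) +
      y * (x * form_inner k g \<omega> \<eta> c p + y * form_inner k g \<eta> \<eta> c p)"
    unfolding \<sigma>_def form_inner_linear_left ..
  also have "form_inner k g \<eta> \<omega> c p = form_inner k g \<omega> \<eta> c p" by (rule comm)
  finally show ?thesis by (simp add: power2_eq_square algebra_simps)
qed

text \<open>Cauchy-Schwarz follows from semidefiniteness alone: the quadratic form in \<open>(x, y)\<close> that
  belongs to \<open>x\<omega> + y\<eta>\<close> is nonnegative at \<open>(e, -b)\<close> and \<open>(-b, a)\<close>, which gives \<open>ae - b\<^sup>2 \<ge> 0\<close> unless
  \<open>a = e = 0\<close>. In that case the points \<open>(1, 1)\<close> and \<open>(1, -1)\<close> give \<open>b = 0\<close>.\<close>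

lemma form_inner_facts:
  fixes g :: "('m, 'n::finite) metric"
  assumes "riemannian_metric A g" "c \<in> A" "p \<in> cdom c"
  shows form_inner_nonneg: "form_inner k g \<omega> \<omega> c p \<ge> 0"
    and form_inner_variation: "form_inner k g (\<lambda>c p vs. \<omega> c p vs + t * \<eta> c p vs) (\<lambda>c p vs. \<omega> c p vs + t * \<eta> c p vs) c p =
       form_inner k g \<omega> \<omega> c p + 2 * t * form_inner k g \<omega> \<eta> c p + t\<^sup>2 * form_inner k g \<eta> \<eta> c p"
    and form_inner_Cauchy_Schwarz:
      "(form_inner k g \<omega> \<eta> c p)\<^sup>2 \<le> form_inner k g \<omega> \<omega> c p * form_inner k g \<eta> \<eta> c p"
proof -
  obtain M :: "((real, 'n) vec, 'n) vec" where M: "matrix_inv (gram g c p) = M ** transpose M"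
    by (rule gram_inverse[OF assms])
  have sym: "matrix_inv (gram g c p) $ i $ j = matrix_inv (gram g c p) $ j $ i" for i j
    unfolding M by (simp add: matrix_matrix_mult_def transpose_def mult.commute)
  show nonneg: "form_inner k g \<omega> \<omega> c p \<ge> 0" for \<omega>
    unfolding form_inner_def M
    using tensor_power_nonneg[where u = "\<lambda>I. \<omega> c p (map (\<lambda>i. axis i 1) I)"]
    by (intro divide_nonneg_nonneg) simp_all
  show "form_inner k g (\<lambda>c p vs. \<omega> c p vs + t * \<eta> c p vs) (\<lambda>c p vs. \<omega> c p vs + t * \<eta> c p vs) c p =
       form_inner k g \<omega> \<omega> c p + 2 * t * form_inner k g \<omega> \<eta> c p + t\<^sup>2 * form_inner k g \<eta> \<eta> c p"
    using form_inner_square[where x = 1 and y = t and g = g and c = c and p = p and \<omega> = \<omega> and \<eta> = \<eta> and k = k, OF sym] by simp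
  let ?a = "form_inner k g \<omega> \<omega> c p" and ?b = "form_inner k g \<omega> \<eta> c p" and ?e = "form_inner k g \<eta> \<eta> c p"
  have q: "0 \<le> x\<^sup>2 * ?a + 2 * x * y * ?b + y\<^sup>2 * ?e" for x y
    using nonneg[of "\<lambda>c p vs. x * \<omega> c p vs + y * \<eta> c p vs"]
      form_inner_square[where x = x and y = y and g = g and c = c and p = p and \<omega> = \<omega> and \<eta> = \<eta> and k = k, OF sym] by simp
  have "0 \<le> ?e * (?a * ?e - ?b\<^sup>2)"
    using q[of ?e "- ?b"] by (simp add: power2_eq_square algebra_simps)
  moreover have "0 \<le> ?a * (?a * ?e - ?b\<^sup>2)"
    using q[of "- ?b" ?a] by (simp add: power2_eq_square algebra_simps)
  moreover have "?b = 0" if "?a = 0" "?e = 0"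
    using q[of 1 1] q[of 1 "-1"] that by simp
  ultimately show "?b\<^sup>2 \<le> ?a * ?e"
    using nonneg[of \<omega>] nonneg[of \<eta>]
    by (smt (verit) mult_pos_neg power2_eq_square mult_zero_left)
qed

lemma continuous_on_gram_entry:
  assumes "riemannian_metric A g" "c \<in> A"
  shows "continuous_on (cimg c) (\<lambda>x. gram g c (cinv c x) $ i $ j)"
proof -
  have "smooth_rel (cimg c) (\<lambda>x. g c (cinv c x) (axis i 1) (axis j 1))"
    using assms unfolding riemannian_metric_def by blast
  then show ?thesis by (simp add: gram_def smooth_rel_imp_continuous_on)
qed

lemma continuous_on_form_inner:
  assumes A: "smooth_atlas X A" "c \<in> A" and g: "riemannian_metric A g"
    and \<omega>: "continuous_coeffs A k \<omega>" and \<eta>: "continuous_coeffs A k \<eta>"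
  shows "continuous_on (cimg c) (\<lambda>x. form_inner k g \<omega> \<eta> c (cinv c x))"
proof -
  have "det (gram g c (cinv c x)) \<noteq> 0" if "x \<in> cimg c" for x
    by (rule gram_inverse[OF g A(2) cinv_in_domain[OF A that]]) simp
  then have H: "continuous_on (cimg c) (\<lambda>x. matrix_inv (gram g c (cinv c x)) $ i $ j)" for i j
    by (intro continuous_on_matrix_inv_entry continuous_on_gram_entry[OF g A(2)])
  have co: "continuous_on (cimg c) (\<lambda>x. \<theta> c (cinv c x) (map (\<lambda>i. axis i 1) I))"
    if "continuous_coeffs A k \<theta>" "I \<in> {I. length I = k}" for \<theta> I
    using that A(2) by (simp add: continuous_coeffs_def)
  show ?thesis
    unfolding form_inner_def
    by (intro continuous_on_divide continuous_on_sum continuous_on_mult continuous_on_prod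
        continuous_on_const H co[OF \<omega>] co[OF \<eta>]) auto
qed

text \<open>The inverse metric contributes \<open>s\<close> to the power \<open>-(n - 1)\<close> to the squared norm, the determinant \<open>s\<close> to the power
  \<open>n\<close>; one factor \<open>s\<close> remains under the root. If \<open>s = 0\<close>, both sides vanish with the factor \<open>s\<close>.\<close>

lemma conformal_density:
  fixes g h :: "('m, 'n::{finite, linorder}) metric"
  assumes h: "\<And>u v. h c p u v = s * g c p u v" and s: "s \<ge> 0"
    and det: "det (gram g c p) > 0"
  shows "form_norm (CARD('n) - 1) h \<omega> c p * sqrt (det (gram h c p)) =
     sqrt s * form_norm (CARD('n) - 1) g \<omega> c p * sqrt (det (gram g c p))"
proof -
  let ?k = "CARD('n) - 1"
  have gram: "gram h c p = s *\<^sub>R gram g c p"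
    by (simp add: gram_def h vec_eq_iff)
  have dt: "det (gram h c p) = s ^ ?k * s * det (gram g c p)"
    unfolding gram det_scaleR using power_minus_mult[of "CARD('n)" s] by simp
  show ?thesis
  proof (cases "s = 0")
    case True
    then show ?thesis by (simp add: dt)
  next
    case False
    then have s: "s > 0" using s by simp
    have "form_inner ?k h \<omega> \<omega> c p = inverse s ^ ?k * form_inner ?k g \<omega> \<omega> c p"
      using det s unfolding form_inner_def gram
      by (simp add: matrix_inv_scaleR prod.distrib sum_distrib_left mult.assoc)
    then show ?thesis
      using s unfolding form_norm_def dt
      by (simp add: real_sqrt_mult real_sqrt_inverse power_inverse)
  qed
qed

section \<open>The first variations\<close>

text \<open>The common value \<open>D\<close> is the integral of \<open>\<langle>\<beta>, \<gamma>\<rangle>\<close> with respect to the volume form of \<open>g\<close>.\<close>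

lemma first_variations:
  fixes X :: "'m topology" and A :: "('m, 'n::{finite, linorder}) chart set"
    and g h :: "('m, 'n) metric" and \<beta> \<gamma> :: "('m, 'n) form"
  defines "k \<equiv> CARD('n) - 1"
  defines "h \<equiv> \<lambda>c p u v. (form_norm k g \<beta> c p)\<^sup>2 * g c p u v"
  assumes X: "compact_space X" "Hausdorff_space X" and A: "smooth_atlas X A"
    and g: "riemannian_metric A g"
    and cc: "continuous_coeffs A k \<beta>" "continuous_coeffs A k \<gamma>"
  obtains D where
    "((\<lambda>t. L2_norm_squared X A k g (\<lambda>c p vs. \<beta> c p vs + t * \<gamma> c p vs)) has_real_derivative 2 * D) (at 0)"
    "((\<lambda>t. L1_norm X A k h (\<lambda>c p vs. \<beta> c p vs + t * \<gamma> c p vs)) has_real_derivative D) (at 0)"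
proof -
  let ?\<omega> = "\<lambda>t c p vs. \<beta> c p vs + t * \<gamma> c p vs"
  obtain C \<rho> where C: "partition_of_unity X A C \<rho>"
    and int: "\<And>\<omega>. mfd_integral X A \<omega> =
      (\<Sum>c\<in>C. LINT x:cimg c|lborel. \<rho> c (cinv c x) * \<omega> c (cinv c x) std_frame)"
    using mfd_integral_formula[OF X A] by blast
  define w where "w c x = \<rho> c (cinv c x) * vol_form g c (cinv c x) std_frame" for c x
  \<comment> \<open>the coordinate volume of the standard frame, a constant factor of all volume densities\<close>
  define d where "d = det ((\<chi> i. std_frame ! coord_pos i) :: ((real, 'n) vec, 'n) vec)"
  have vol: "vol_form g' c p std_frame = sqrt (det (gram g' c p)) * d" for g' :: "('m, 'n) metric" and c p
    by (simp add: vol_form_def std_frame_def d_def)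
  define a b e where "a c x = form_inner k g \<beta> \<beta> c (cinv c x)"
    and "b c x = form_inner k g \<beta> \<gamma> c (cinv c x)"
    and "e c x = form_inner k g \<gamma> \<gamma> c (cinv c x)" for c x
  define q where "q t c x = a c x + 2 * t * b c x + t\<^sup>2 * e c x" for t c x
  have norm: "form_inner k g (?\<omega> t) (?\<omega> t) c (cinv c x) = q t c x"
    and q: "q t c x \<ge> 0" and a: "a c x \<ge> 0" and cs: "(b c x)\<^sup>2 \<le> a c x * e c x"
    and sq: "(form_norm k g (?\<omega> t) c (cinv c x))\<^sup>2 = q t c x"
    and L1: "form_norm k h (?\<omega> t) c (cinv c x) * vol_form h c (cinv c x) std_frame =
        sqrt (a c x) * sqrt (q t c x) * vol_form g c (cinv c x) std_frame"
    if c: "c \<in> C" and x: "x \<in> cimg c" for c x t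
  proof -
    have cA: "c \<in> A" using C c unfolding partition_of_unity_def by blast
    note dom = cinv_in_domain[OF A cA x]
    note facts = form_inner_facts[OF g cA dom]
    show norm: "form_inner k g (?\<omega> t) (?\<omega> t) c (cinv c x) = q t c x"
      unfolding q_def a_def b_def e_def by (rule facts(2))
    show q: "q t c x \<ge> 0" unfolding norm[symmetric] by (rule facts(1))
    show a: "a c x \<ge> 0" unfolding a_def by (rule facts(1))
    show "(b c x)\<^sup>2 \<le> a c x * e c x" unfolding a_def b_def e_def by (rule facts(3))
    show "(form_norm k g (?\<omega> t) c (cinv c x))\<^sup>2 = q t c x"
      using q by (simp add: form_norm_def norm)
    have det: "det (gram g c (cinv c x)) > 0"
      by (rule gram_inverse[OF g cA dom])
    have "h c (cinv c x) u v = a c x * g c (cinv c x) u v" for u v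
      using a by (simp add: h_def form_norm_def a_def)
    from conformal_density[where h = h and g = g and c = c and p = "cinv c x" and s = "a c x", OF this a det, folded k_def]
    show "form_norm k h (?\<omega> t) c (cinv c x) * vol_form h c (cinv c x) std_frame =
        sqrt (a c x) * sqrt (q t c x) * vol_form g c (cinv c x) std_frame"
      by (simp add: vol form_norm_def norm)
  qed
  have integrable: "set_integrable lborel (cimg c) (\<lambda>x. w c x * f x)"
    if c: "c \<in> C" and f: "continuous_on (cimg c) f" for c f
  proof -
    have cA: "c \<in> A" and \<rho>: "continuous_map X euclideanreal (\<rho> c)"
      "X closure_of {p \<in> topspace X. \<rho> c p \<noteq> 0} \<subseteq> cdom c"
      using C c unfolding partition_of_unity_def by blast+
    have "continuous_on (cimg c) (\<lambda>x. vol_form g c (cinv c x) std_frame * f x)"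
      unfolding vol
      by (intro continuous_on_mult continuous_on_real_sqrt continuous_on_det_entries
          continuous_on_gram_entry[OF g cA] continuous_on_const f)
    from chart_integrable[OF A cA X(1) \<rho> this] show ?thesis
      by (simp add: w_def mult.assoc)
  qed
  have cont: "continuous_on (cimg c) (a c)" "continuous_on (cimg c) (b c)" "continuous_on (cimg c) (e c)"
    if c: "c \<in> C" for c
  proof -
    have cA: "c \<in> A" using C c unfolding partition_of_unity_def by blast
    show "continuous_on (cimg c) (a c)" "continuous_on (cimg c) (b c)" "continuous_on (cimg c) (e c)"
      unfolding a_def b_def e_def using continuous_on_form_inner[OF A cA g] cc by blast+
  qed
  have borel: "cimg c \<in> sets lborel" if "c \<in> C" for c
    using C that chart_image_borel[OF A] unfolding partition_of_unity_def by auto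
  define D where "D = (\<Sum>c\<in>C. LINT x:cimg c|lborel. w c x * b c x)"
  have "L2_norm_squared X A k g (?\<omega> t) =
      (\<Sum>c\<in>C. LINT x:cimg c|lborel. w c x * q t c x)" for t
    unfolding L2_norm_squared_def int
    by (intro sum.cong set_lebesgue_integral_cong refl borel) (simp_all add: sq w_def)
  moreover have "((\<lambda>t. \<Sum>c\<in>C. LINT x:cimg c|lborel. w c x * q t c x) has_real_derivative
      (\<Sum>c\<in>C. 2 * (LINT x:cimg c|lborel. w c x * b c x))) (at 0)"
    unfolding q_def
    by (intro DERIV_sum derivative_integral_quadratic integrable cont)
  moreover have "L1_norm X A k h (?\<omega> t) =
      (\<Sum>c\<in>C. LINT x:cimg c|lborel. w c x * (sqrt (a c x) * sqrt (q t c x)))" for t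
    unfolding L1_norm_def int
    by (intro sum.cong set_lebesgue_integral_cong refl borel) (simp_all add: L1 w_def)
  moreover have "((\<lambda>t. \<Sum>c\<in>C. LINT x:cimg c|lborel. w c x * (sqrt (a c x) * sqrt (q t c x))) has_real_derivative
      (\<Sum>c\<in>C. LINT x:cimg c|lborel. w c x * b c x)) (at 0)"
  proof (intro DERIV_sum)
    fix c assume c: "c \<in> C"
    have sqrt_cont: "continuous_on (cimg c) (\<lambda>x. sqrt (a c x) * sqrt (a c x + 2 * t * b c x + t\<^sup>2 * e c x))" for t
      using cont[OF c] by (intro continuous_intros)
    show "((\<lambda>t. LINT x:cimg c|lborel. w c x * (sqrt (a c x) * sqrt (q t c x))) has_real_derivative
      (LINT x:cimg c|lborel. w c x * b c x)) (at 0)"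
      unfolding q_def
      by (rule derivative_integral_weighted_sqrt[OF borel[OF c] integrable[OF c cont(1)[OF c]]
            integrable[OF c cont(2)[OF c]] integrable[OF c cont(3)[OF c]] integrable[OF c sqrt_cont]
            a[OF c] cs[OF c] q[OF c, unfolded q_def]])
  qed
  ultimately show thesis
    by (intro that[of D]) (simp_all add: D_def sum_distrib_left)
qed

theorem theorem5p1:
  fixes X :: "'m topology"
    and A :: "('m, 'n::{finite, linorder}) chart set"
    and ghat gbar :: "('m, 'n) metric"
    and \<beta> \<beta>bd :: "('m, 'n) form"
    and V :: "('m, 'n) form set"
  assumes "CARD('n) \<ge> 3"
    and "oriented_manifold X A" and "compact_space X"
    and "riemannian_metric A ghat"
    and "\<beta> \<in> Omega X A (CARD('n) - 1)"
    and "ext_deriv A \<beta> = zero_form"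
    and "\<forall>c\<in>A. \<forall>p\<in>cdom c. \<beta> c p \<noteq> (\<lambda>vs. 0)"
    and "\<beta>bd \<in> Omega_bdry A (CARD('n) - 1)"
    and "bdry_pullback A \<beta> = \<beta>bd"
    and "gbar = (\<lambda>c p u v. (form_norm (CARD('n) - 1) ghat \<beta> c p)\<^sup>2 * ghat c p u v)"
    and "V \<in> {variations_closed X A, variations_exact X A, variations_lie X A \<beta>}"
  shows "stationary_point (L2_norm_squared X A (CARD('n) - 1) ghat) V \<beta> \<longleftrightarrow>
         stationary_point (L1_norm X A (CARD('n) - 1) gbar) V \<beta>"
proof -
  have A: "smooth_atlas X A" and H: "Hausdorff_space X"
    using assms(2) unfolding oriented_manifold_def by blast+
  have "((\<lambda>t. L2_norm_squared X A (CARD('n) - 1) ghat (\<lambda>c p vs. \<beta> c p vs + t * \<gamma> c p vs)) has_real_derivative 0) (at 0) \<longleftrightarrow>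
      ((\<lambda>t. L1_norm X A (CARD('n) - 1) gbar (\<lambda>c p vs. \<beta> c p vs + t * \<gamma> c p vs)) has_real_derivative 0) (at 0)"
    (is "(?L2 has_real_derivative _) _ \<longleftrightarrow> (?L1 has_real_derivative _) _") if \<gamma>: "\<gamma> \<in> V" for \<gamma>
  proof -
    obtain D where D2: "(?L2 has_real_derivative 2 * D) (at 0)" and D1: "(?L1 has_real_derivative D) (at 0)"
      by (rule first_variations[OF assms(3) H A assms(4) continuous_coeffs_Omega[OF A assms(5)]
            variations_continuous_coeffs[OF A assms(5,11) \<gamma>], folded assms(10)]) (rule that)
    have zero_iff: "(F has_real_derivative 0) (at 0) \<longleftrightarrow> E = 0" if "(F has_real_derivative E) (at 0)"
      for F :: "real \<Rightarrow> real" and E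
      using DERIV_unique[OF that] that by blast
    show ?thesis
      unfolding zero_iff[OF D2] zero_iff[OF D1] by simp
  qed
  then show ?thesis
    unfolding stationary_point_def by blast
qed

end
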